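(* Let $(R,\mathfrak m,k)$ be a commutative noetherian local ring, $Q$ a finite quiver, and $I\triangleleft RQ$ a two-sided ideal that is arrow-radical, bounded below and special. Let $\Lambda=RQ/I$ and let $p$ be an admissible non-trivial path with left arrow $b$ and right arrow $a$. Then: (1) Any non-trivial (i.e. non-zero) left submodule of $\Lambda p$ has the form $\Lambda q$ for an admissible path $q$ with right subpath $p$. (2) Any non-trivial (i.e. non-zero) right submodule of $p\Lambda$ has the form $q\Lambda$ for an admissible path $q$ with left subpath $p$. (3) If $q$ is an admissible path with right arrow $a$ and $\Lambda p=\Lambda q$, then $p=q$. (4) If $q$ is an admissible path with left arrow $b$ and $p\Lambda=q\Lambda$, then $p=q$.
   Context: Quivers: a finite quiver $Q=(Q_0,Q_1,h,t)$ has finite sets of vertices $Q_0$ and arrows $Q_1$, and head and tail maps $h,t:Q_1\to Q_0$. Each vertex $v$ has a trivial path $e_v$ (length $0$, head and tail $v$); a non-trivial path of length $n\ge1$ is $a_n\cdots a_1$ with arrows satisfying $t(a_{i+1})=h(a_i)$; its left arrow is $a_n$ and its right arrow is $a_1$. $RQ$ is the free $R$-module on the paths, with $pq$ the composition if $t(p)=h(q)$ and $0$ otherwise. $A_\ell\subseteq RQ$ is the $R$-span of paths of length $\ell$, $A=\bigoplus_{\ell\ge1}A_\ell$, and $\mathfrak mQ$ is the set of $R$-linear combinations of paths with coefficients in $\mathfrak m$. A path $p$ is a right subpath of $q$ if $q=q'p$ for some (possibly trivial) path $q'$, and a left subpath of $q$ if $q=pq'$ for some (possibly trivial) path $q'$.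 A path is inadmissible if it lies in $I$, and admissible otherwise. For $\Lambda=RQ/I$, elements of $RQ$ are identified with their cosets when acting on $\Lambda$ (e.g. $\Lambda p=\Lambda(p+I)$). For a module $M$, $\mathrm{rad}(M)$ is its Jacobson radical; $M$ is local if it has a unique maximal submodule (then equal to $\mathrm{rad}(M)$). - $I$ is arrow-radical if for every vertex $v$: $\Lambda e_v$ is a local left module with $\mathrm{rad}(\Lambda e_v)=\sum_{t(c)=v}\Lambda c$, and $e_v\Lambda$ is a local right module with $\mathrm{rad}(e_v\Lambda)=\sum_{h(c)=v}c\Lambda$ (sums over arrows $c$). - $I$ is bounded below if $A^m\subseteq I+\mathfrak mQ$ and $\mathfrak mQ\subseteq I+\sum_{\ell=1}^nA_\ell$ for some integers $m,n>0$. - $I$ is special if for every arrow $y$ there is at most one arrow $x$ with $t(x)=h(y)$ and $xy\notin I$, and at most one arrow $z$ with $h(z)=t(y)$ and $yz\notin I$. *)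

theory Defs
  imports
    "HOL-Algebra.QuotRing"
    "HOL-Algebra.Ideal_Product"
    "HOL-Algebra.Ring_Divisibility"
    "Graph_Theory.Arc_Walk"
begin

section \<open>Local rings\<close>

definition local_ring_with :: "('r, 'x) ring_scheme \<Rightarrow> 'r set \<Rightarrow> bool" where
  "local_ring_with R \<mm> \<longleftrightarrow>
     cring R \<and> maximalideal \<mm> R \<and> (\<forall>J. maximalideal J R \<longrightarrow> J = \<mm>)"


section \<open>Submodules of a not necessarily commutative ring\<close>

text \<open>
  HOL-Algebra only has modules over commutative rings.  All modules needed below are one-sided
  ideals of a ring \<open>L\<close>, and \<open>M\<close> always stands for such an ideal.
\<close>

definition left_submodule :: "('l, 'x) ring_scheme \<Rightarrow> 'l set \<Rightarrow> 'l set \<Rightarrow> bool" where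
  "left_submodule L M N \<longleftrightarrow>
     additive_subgroup N L \<and> N \<subseteq> M \<and> (\<forall>l\<in>carrier L. \<forall>x\<in>N. l \<otimes>\<^bsub>L\<^esub> x \<in> N)"

definition right_submodule :: "('l, 'x) ring_scheme \<Rightarrow> 'l set \<Rightarrow> 'l set \<Rightarrow> bool" where
  "right_submodule L M N \<longleftrightarrow>
     additive_subgroup N L \<and> N \<subseteq> M \<and> (\<forall>l\<in>carrier L. \<forall>x\<in>N. x \<otimes>\<^bsub>L\<^esub> l \<in> N)"

definition maximal_left_submodule :: "('l, 'x) ring_scheme \<Rightarrow> 'l set \<Rightarrow> 'l set \<Rightarrow> bool" where
  "maximal_left_submodule L M N \<longleftrightarrow>
     left_submodule L M N \<and> N \<noteq> M \<and>
     (\<forall>N'. left_submodule L M N' \<and> N \<subseteq> N' \<longrightarrow> N' = N \<or> N' = M)"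

definition maximal_right_submodule :: "('l, 'x) ring_scheme \<Rightarrow> 'l set \<Rightarrow> 'l set \<Rightarrow> bool" where
  "maximal_right_submodule L M N \<longleftrightarrow>
     right_submodule L M N \<and> N \<noteq> M \<and>
     (\<forall>N'. right_submodule L M N' \<and> N \<subseteq> N' \<longrightarrow> N' = N \<or> N' = M)"

text \<open>The Jacobson radical; it is \<open>M\<close> itself if \<open>M\<close> has no maximal submodule.\<close>

definition left_rad :: "('l, 'x) ring_scheme \<Rightarrow> 'l set \<Rightarrow> 'l set" where
  "left_rad L M = M \<inter> \<Inter> {N. maximal_left_submodule L M N}"

definition right_rad :: "('l, 'x) ring_scheme \<Rightarrow> 'l set \<Rightarrow> 'l set" where
  "right_rad L M = M \<inter> \<Inter> {N. maximal_right_submodule L M N}"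

definition left_local :: "('l, 'x) ring_scheme \<Rightarrow> 'l set \<Rightarrow> bool" where
  "left_local L M \<longleftrightarrow> (\<exists>!N. maximal_left_submodule L M N)"

definition right_local :: "('l, 'x) ring_scheme \<Rightarrow> 'l set \<Rightarrow> bool" where
  "right_local L M \<longleftrightarrow> (\<exists>!N. maximal_right_submodule L M N)"

definition left_cyclic :: "('l, 'x) ring_scheme \<Rightarrow> 'l \<Rightarrow> 'l set" where
  "left_cyclic L x = {l \<otimes>\<^bsub>L\<^esub> x | l. l \<in> carrier L}"

definition right_cyclic :: "('l, 'x) ring_scheme \<Rightarrow> 'l \<Rightarrow> 'l set" where
  "right_cyclic L x = {x \<otimes>\<^bsub>L\<^esub> l | l. l \<in> carrier L}"

text \<open>The sum of a finite family of additive subgroups; it is \<open>0\<close> for the empty family.\<close>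

definition family_sum :: "('l, 'x) ring_scheme \<Rightarrow> ('i \<Rightarrow> 'l set) \<Rightarrow> 'i set \<Rightarrow> 'l set" where
  "family_sum L N C = {finsum L x C | x. \<forall>c\<in>C. x c \<in> N c}"

primrec ideal_power :: "('l, 'x) ring_scheme \<Rightarrow> 'l set \<Rightarrow> nat \<Rightarrow> 'l set" where
  "ideal_power L J 0 = carrier L"
| "ideal_power L J (Suc n) = ideal_prod L (ideal_power L J n) J"


section \<open>Paths\<close>

text \<open>
  A quiver is a (directed multi-)graph in the sense of \<^locale>\<open>fin_digraph\<close>.  Besides its arrows,
  a path records its tail and head, which is needed for trivial paths.  The arrows are listed in the
  order in which they are traversed: the path \<open>a\<^sub>n \<dots> a\<^sub>1\<close> has the list \<open>[a\<^sub>1, \<dots>, a\<^sub>n]\<close>, so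
  its right arrow is the first list element and its left arrow is the last one.
\<close>

datatype ('v, 'a) path =
  Path (path_tail: 'v) (path_arrows: "'a list") (path_head: 'v)

definition paths :: "('v, 'a) pre_digraph \<Rightarrow> ('v, 'a) path set" where
  "paths Q = {p. pre_digraph.awalk Q (path_tail p) (path_arrows p) (path_head p)}"

definition path_length :: "('v, 'a) path \<Rightarrow> nat" where
  "path_length p = length (path_arrows p)"

definition trivial_path :: "'v \<Rightarrow> ('v, 'a) path" where
  "trivial_path v = Path v [] v"

definition arrow_path :: "('v, 'a) pre_digraph \<Rightarrow> 'a \<Rightarrow> ('v, 'a) path" where
  "arrow_path Q c = Path (tail Q c) [c] (head Q c)"

text \<open>Both are only meaningful for non-trivial paths.\<close>

definition right_arrow :: "('v, 'a) path \<Rightarrow> 'a" where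
  "right_arrow p = hd (path_arrows p)"

definition left_arrow :: "('v, 'a) path \<Rightarrow> 'a" where
  "left_arrow p = last (path_arrows p)"

text \<open>The composition \<open>pq\<close> (first \<open>q\<close>, then \<open>p\<close>), meaningful if the tail of \<open>p\<close> is the head of \<open>q\<close>.\<close>

definition path_comp :: "('v, 'a) path \<Rightarrow> ('v, 'a) path \<Rightarrow> ('v, 'a) path" where
  "path_comp p q = Path (path_tail q) (path_arrows q @ path_arrows p) (path_head p)"

definition right_subpath :: "('v, 'a) pre_digraph \<Rightarrow> ('v, 'a) path \<Rightarrow> ('v, 'a) path \<Rightarrow> bool" where
  "right_subpath Q p q \<longleftrightarrow> (\<exists>q'\<in>paths Q. path_tail q' = path_head p \<and> q = path_comp q' p)"

definition left_subpath :: "('v, 'a) pre_digraph \<Rightarrow> ('v, 'a) path \<Rightarrow> ('v, 'a) path \<Rightarrow> bool" where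
  "left_subpath Q p q \<longleftrightarrow> (\<exists>q'\<in>paths Q. path_tail p = path_head q' \<and> q = path_comp p q')"


section \<open>The path algebra\<close>

definition decompositions ::
    "('v, 'a) pre_digraph \<Rightarrow> ('v, 'a) path \<Rightarrow> (('v, 'a) path \<times> ('v, 'a) path) set" where
  "decompositions Q p =
     {(q, r). q \<in> paths Q \<and> r \<in> paths Q \<and> path_tail q = path_head r \<and> path_comp q r = p}"

text \<open>
  An element of the free module on the paths is its coefficient function, which has finite support
  and vanishes outside the set of paths.  The product is the bilinear extension of the product of
  paths: the coefficient of \<open>p\<close> in \<open>fg\<close> is the sum of \<open>f(q) g(r)\<close> over all \<open>q\<close>, \<open>r\<close> with \<open>qr = p\<close>,
  of which there are only finitely many.
\<close>

definition path_algebra ::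
    "('r, 'x) ring_scheme \<Rightarrow> ('v, 'a) pre_digraph \<Rightarrow> (('v, 'a) path \<Rightarrow> 'r) ring" where
  "path_algebra R Q =
     \<lparr> carrier = {f. range f \<subseteq> carrier R \<and> {p. f p \<noteq> \<zero>\<^bsub>R\<^esub>} \<subseteq> paths Q \<and>
                     finite {p. f p \<noteq> \<zero>\<^bsub>R\<^esub>}},
       monoid.mult = (\<lambda>f g p. finsum R (\<lambda>(q, r). f q \<otimes>\<^bsub>R\<^esub> g r) (decompositions Q p)),
       one = (\<lambda>p. if p \<in> trivial_path ` verts Q then \<one>\<^bsub>R\<^esub> else \<zero>\<^bsub>R\<^esub>),
       zero = (\<lambda>p. \<zero>\<^bsub>R\<^esub>),
       add = (\<lambda>f g p. f p \<oplus>\<^bsub>R\<^esub> g p) \<rparr>"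

definition path_elem :: "('r, 'x) ring_scheme \<Rightarrow> ('v, 'a) path \<Rightarrow> ('v, 'a) path \<Rightarrow> 'r" where
  "path_elem R p = (\<lambda>q. if q = p then \<one>\<^bsub>R\<^esub> else \<zero>\<^bsub>R\<^esub>)"

lemma trivial_path_in_paths:
  assumes "fin_digraph Q" "v \<in> verts Q"
  shows "trivial_path v \<in> paths Q"
proof -
  interpret fin_digraph Q by fact
  show ?thesis using assms by (simp add: trivial_path_def paths_def awalk_Nil_iff)
qed

lemma path_comp_in_paths:
  assumes "fin_digraph Q" "p \<in> paths Q" "q \<in> paths Q" "path_tail p = path_head q"
  shows "path_comp p q \<in> paths Q"
proof -
  interpret fin_digraph Q by fact
  show ?thesis using assms
    by (auto simp: paths_def path_comp_def
        intro: awalk_appendI)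
qed

lemma path_ends_in_verts:
  assumes "fin_digraph Q" "p \<in> paths Q"
  shows "path_tail p \<in> verts Q" "path_head p \<in> verts Q"
proof -
  interpret fin_digraph Q by fact
  show "path_tail p \<in> verts Q" "path_head p \<in> verts Q" using assms
    by (auto simp: paths_def)
qed

lemma path_comp_ends [simp]:
  "path_tail (path_comp p q) = path_tail q" "path_head (path_comp p q) = path_head p"
  by (simp_all add: path_comp_def)

lemma path_comp_assoc: "path_comp (path_comp p q) r = path_comp p (path_comp q r)"
  by (simp add: path_comp_def)

lemma path_comp_trivial [simp]:
  "path_comp (trivial_path (path_head p)) p = p" "path_comp p (trivial_path (path_tail p)) = p"
  by (simp_all add: path_comp_def trivial_path_def)

lemma trivial_path_ends [simp]:
  "path_tail (trivial_path v) = v" "path_head (trivial_path v) = v"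
  by (simp_all add: trivial_path_def)

lemma finite_decompositions:
  assumes "fin_digraph Q"
  shows "finite (decompositions Q p)"
proof -
  interpret fin_digraph Q by fact
  define S where "S = (\<lambda>(i, x). (Path x (drop i (path_arrows p)) (path_head p),
      Path (path_tail p) (take i (path_arrows p)) x)) ` ({..length (path_arrows p)} \<times> verts Q)"
  have "decompositions Q p \<subseteq> S"
  proof
    fix d assume d: "d \<in> decompositions Q p"
    obtain q r where dd: "d = (q, r)" by (cases d) auto
    have "path_tail q \<in> verts Q"
      using d path_ends_in_verts[OF assms, of q] by (auto simp: decompositions_def dd)
    moreover have "p = path_comp q r" "path_tail q = path_head r"
      using d by (auto simp: decompositions_def dd)
    ultimately show "d \<in> S"
      unfolding S_def dd
      by (intro image_eqI[where x = "(length (path_arrows r), path_tail q)"])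
        (auto simp: path_comp_def path.expand)
  qed
  moreover have "finite S" by (simp add: S_def)
  ultimately show ?thesis by (rule finite_subset)
qed

lemma path_algebra_ring:
  fixes R (structure) and Q :: "('v, 'a) pre_digraph"
  assumes "ring R" and Q: "fin_digraph Q"
  shows "ring (path_algebra R Q)"
proof -
  interpret R: ring R by fact
  let ?P = "path_algebra R Q"
  let ?D = "decompositions Q"
  note finD = finite_decompositions[OF Q]
  have carr: "f p \<in> carrier R" if "f \<in> carrier ?P" for f p
    using that by (auto simp: path_algebra_def)
  have supp: "f p = \<zero>" if "f \<in> carrier ?P" "p \<notin> paths Q" for f p
    using that by (auto simp: path_algebra_def)
  have fins: "finite {p. f p \<noteq> \<zero>}" if "f \<in> carrier ?P" for f
    using that by (simp add: path_algebra_def)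
  have carrI: "f \<in> carrier ?P"
    if "\<And>p. f p \<in> carrier R" "\<And>p. p \<notin> paths Q \<Longrightarrow> f p = \<zero>" "{p. f p \<noteq> \<zero>} \<subseteq> S" "finite S"
    for f S
    using that finite_subset by (fastforce simp: path_algebra_def)
  have add: "(f \<oplus>\<^bsub>?P\<^esub> g) p = f p \<oplus> g p" for f g p by (simp add: path_algebra_def)
  have zero: "\<zero>\<^bsub>?P\<^esub> p = \<zero>" for p by (simp add: path_algebra_def)
  have mult: "(f \<otimes>\<^bsub>?P\<^esub> g) p = (\<Oplus>d\<in>?D p. f (fst d) \<otimes> g (snd d))" for f g p
    by (simp add: path_algebra_def case_prod_unfold)
  have one: "\<one>\<^bsub>?P\<^esub> p = (if p \<in> trivial_path ` verts Q then \<one> else \<zero>)" for p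
    by (simp add: path_algebra_def)
  have addc: "f \<oplus>\<^bsub>?P\<^esub> g \<in> carrier ?P" if "f \<in> carrier ?P" "g \<in> carrier ?P" for f g
  proof (rule carrI)
    show "{p. (f \<oplus>\<^bsub>?P\<^esub> g) p \<noteq> \<zero>} \<subseteq> {p. f p \<noteq> \<zero>} \<union> {p. g p \<noteq> \<zero>}"
      by (auto simp: add)
  qed (simp_all add: add carr supp fins that)
  have zeroc: "\<zero>\<^bsub>?P\<^esub> \<in> carrier ?P"
    by (rule carrI[of _ "{}"]) (auto simp: zero)
  have abel: "abelian_group ?P"
  proof (rule abelian_groupI)
    fix f assume f: "f \<in> carrier ?P"
    have "(\<lambda>p. \<ominus> f p) \<in> carrier ?P"
      by (rule carrI[of _ "{p. f p \<noteq> \<zero>}"]) (simp_all add: f carr supp fins subset_iff)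
    moreover have "(\<lambda>p. \<ominus> f p) \<oplus>\<^bsub>?P\<^esub> f = \<zero>\<^bsub>?P\<^esub>"
      using carr[OF f] by (auto simp: add zero R.l_neg)
    ultimately show "\<exists>g\<in>carrier ?P. g \<oplus>\<^bsub>?P\<^esub> f = \<zero>\<^bsub>?P\<^esub>" by blast
  qed (auto simp: add zero fun_eq_iff carr R.a_ac addc zeroc)
  have multc: "f \<otimes>\<^bsub>?P\<^esub> g \<in> carrier ?P" if fg: "f \<in> carrier ?P" "g \<in> carrier ?P" for f g
  proof (rule carrI)
    show "{p. (f \<otimes>\<^bsub>?P\<^esub> g) p \<noteq> \<zero>} \<subseteq>
        (\<lambda>(q, r). path_comp q r) ` ({p. f p \<noteq> \<zero>} \<times> {p. g p \<noteq> \<zero>})"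
    proof (safe, rule ccontr)
      fix p assume ne: "(f \<otimes>\<^bsub>?P\<^esub> g) p \<noteq> \<zero>"
        and ni: "p \<notin> (\<lambda>(q, r). path_comp q r) ` ({p. f p \<noteq> \<zero>} \<times> {p. g p \<noteq> \<zero>})"
      have "f (fst d) \<otimes> g (snd d) = \<zero>" if "d \<in> ?D p" for d
      proof -
        have "p = path_comp (fst d) (snd d)" using that by (auto simp: decompositions_def)
        hence "f (fst d) = \<zero> \<or> g (snd d) = \<zero>" using ni by force
        thus ?thesis by (auto simp: fg carr)
      qed
      hence "(f \<otimes>\<^bsub>?P\<^esub> g) p = \<zero>" unfolding mult by (rule R.add.finprod_one_eqI)
      thus False using ne by simp
    qed
    show "(f \<otimes>\<^bsub>?P\<^esub> g) p \<in> carrier R" for p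
      unfolding mult by (rule R.finsum_closed) (auto simp: fg carr)
    show "(f \<otimes>\<^bsub>?P\<^esub> g) p = \<zero>" if "p \<notin> paths Q" for p
    proof -
      have "?D p = {}" using that path_comp_in_paths[OF Q] by (auto simp: decompositions_def)
      thus ?thesis by (simp add: mult)
    qed
  qed (simp add: fg fins)
  have onec: "\<one>\<^bsub>?P\<^esub> \<in> carrier ?P"
    by (rule carrI[of _ "trivial_path ` verts Q"])
      (use trivial_path_in_paths[OF Q] fin_digraph.finite_verts[OF Q] in \<open>auto simp: one\<close>)
  have assoc: "(f \<otimes>\<^bsub>?P\<^esub> g) \<otimes>\<^bsub>?P\<^esub> h = f \<otimes>\<^bsub>?P\<^esub> (g \<otimes>\<^bsub>?P\<^esub> h)"
    if f: "f \<in> carrier ?P" and g: "g \<in> carrier ?P" and h: "h \<in> carrier ?P" for f g h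
  proof
    fix p
    define T where "T = {(q, r, s). q \<in> paths Q \<and> r \<in> paths Q \<and> s \<in> paths Q \<and>
      path_tail q = path_head r \<and> path_tail r = path_head s \<and> path_comp q (path_comp r s) = p}"
    let ?F = "\<lambda>(q, r, s). f q \<otimes> (g r \<otimes> h s)"
    define A where "A = (\<lambda>d :: ('v, 'a) path \<times> ('v, 'a) path. (\<lambda>e. (fst e, snd e, snd d)) ` ?D (fst d))"
    define B where "B = (\<lambda>d :: ('v, 'a) path \<times> ('v, 'a) path. (\<lambda>e. (fst d, fst e, snd e)) ` ?D (snd d))"
    have TA: "T = (\<Union>d\<in>?D p. A d)"
    proof (intro equalityI subsetI)
      fix t assume "t \<in> T"
      then obtain q r s where t: "t = (q, r, s)" and
        P: "q \<in> paths Q" "r \<in> paths Q" "s \<in> paths Q" "path_tail q = path_head r"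
           "path_tail r = path_head s" "path_comp q (path_comp r s) = p"
        by (auto simp: T_def)
      have "(path_comp q r, s) \<in> ?D p" "(q, r) \<in> ?D (path_comp q r)"
        using P path_comp_in_paths[OF Q] by (auto simp: decompositions_def path_comp_assoc)
      thus "t \<in> (\<Union>d\<in>?D p. A d)" unfolding A_def t by force
    qed (auto simp: A_def T_def decompositions_def path_comp_assoc)
    have TB: "T = (\<Union>d\<in>?D p. B d)"
    proof (intro equalityI subsetI)
      fix t assume "t \<in> T"
      then obtain q r s where t: "t = (q, r, s)" and
        P: "q \<in> paths Q" "r \<in> paths Q" "s \<in> paths Q" "path_tail q = path_head r"
           "path_tail r = path_head s" "path_comp q (path_comp r s) = p"
        by (auto simp: T_def)
      have "(q, path_comp r s) \<in> ?D p" "(r, s) \<in> ?D (path_comp r s)"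
        using P path_comp_in_paths[OF Q] by (auto simp: decompositions_def)
      thus "t \<in> (\<Union>d\<in>?D p. B d)" unfolding B_def t by force
    qed (auto simp: B_def T_def decompositions_def)
    have rA: "d = (path_comp (fst t) (fst (snd t)), snd (snd t))" if td: "t \<in> A d" for d t
    proof -
      obtain x where t: "t = (fst x, snd x, snd d)" and x: "x \<in> ?D (fst d)"
        by (rule imageE[OF td[unfolded A_def]])
      have "path_comp (fst x) (snd x) = fst d"
        using x by (simp add: decompositions_def case_prod_unfold)
      thus ?thesis by (simp add: t)
    qed
    have dA: "pairwise (\<lambda>d e. disjnt (A d) (A e)) (?D p)"
    proof (intro pairwiseI)
      fix d e :: "('v, 'a) path \<times> ('v, 'a) path" assume ne: "d \<noteq> e"
      have False if t: "t \<in> A d" "t \<in> A e" for t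
        using ne trans[OF rA[OF t(1)] rA[OF t(2), symmetric]] by (rule notE)
      thus "disjnt (A d) (A e)" unfolding disjnt_iff by (intro allI notI) (elim conjE)
    qed
    have rB: "d = (fst t, path_comp (fst (snd t)) (snd (snd t)))" if td: "t \<in> B d" for d t
    proof -
      obtain x where t: "t = (fst d, fst x, snd x)" and x: "x \<in> ?D (snd d)"
        by (rule imageE[OF td[unfolded B_def]])
      have "path_comp (fst x) (snd x) = snd d"
        using x by (simp add: decompositions_def case_prod_unfold)
      thus ?thesis by (simp add: t)
    qed
    have dB: "pairwise (\<lambda>d e. disjnt (B d) (B e)) (?D p)"
    proof (intro pairwiseI)
      fix d e :: "('v, 'a) path \<times> ('v, 'a) path" assume ne: "d \<noteq> e"
      have False if t: "t \<in> B d" "t \<in> B e" for t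
        using ne trans[OF rB[OF t(1)] rB[OF t(2), symmetric]] by (rule notE)
      thus "disjnt (B d) (B e)" unfolding disjnt_iff by (intro allI notI) (elim conjE)
    qed
    have "((f \<otimes>\<^bsub>?P\<^esub> g) \<otimes>\<^bsub>?P\<^esub> h) p = (\<Oplus>d\<in>?D p. finsum R ?F (A d))"
      unfolding mult[of "f \<otimes>\<^bsub>?P\<^esub> g"]
    proof (rule R.finsum_cong')
      fix d
      have "(f \<otimes>\<^bsub>?P\<^esub> g) (fst d) \<otimes> h (snd d) =
          (\<Oplus>e\<in>?D (fst d). f (fst e) \<otimes> g (snd e) \<otimes> h (snd d))"
        unfolding mult by (rule R.finsum_ldistr) (auto simp: finD f g h carr)
      also have "\<dots> = (\<Oplus>e\<in>?D (fst d). ?F (fst e, snd e, snd d))"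
        by (rule R.finsum_cong') (auto simp: R.m_assoc f g h carr)
      also have "\<dots> = finsum R ?F (A d)"
        unfolding A_def
        by (rule R.finsum_reindex[symmetric])
          (auto simp: inj_on_def f g h carr)
      finally show "(f \<otimes>\<^bsub>?P\<^esub> g) (fst d) \<otimes> h (snd d) = finsum R ?F (A d)" .
    qed (auto intro!: R.finsum_closed simp: f g h carr multc A_def B_def)
    also have "\<dots> = finsum R ?F T"
      unfolding TA
      by (rule R.add.finprod_UN_disjoint[symmetric])
        (use dA in \<open>auto simp: A_def finD f g h carr\<close>)
    also have "\<dots> = (\<Oplus>d\<in>?D p. finsum R ?F (B d))"
      unfolding TB
      by (rule R.add.finprod_UN_disjoint)
        (use dB in \<open>auto simp: B_def finD f g h carr\<close>)
    also have "\<dots> = (f \<otimes>\<^bsub>?P\<^esub> (g \<otimes>\<^bsub>?P\<^esub> h)) p"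
      unfolding mult[of f]
    proof (rule R.finsum_cong'[symmetric])
      fix d
      have "f (fst d) \<otimes> (g \<otimes>\<^bsub>?P\<^esub> h) (snd d) =
          (\<Oplus>e\<in>?D (snd d). f (fst d) \<otimes> (g (fst e) \<otimes> h (snd e)))"
        unfolding mult by (rule R.finsum_rdistr) (auto simp: finD f g h carr)
      also have "\<dots> = (\<Oplus>e\<in>?D (snd d). ?F (fst d, fst e, snd e))"
        by (simp add: case_prod_unfold)
      also have "\<dots> = finsum R ?F (B d)"
        unfolding B_def
        by (rule R.finsum_reindex[symmetric])
          (auto simp: inj_on_def f g h carr)
      finally show "f (fst d) \<otimes> (g \<otimes>\<^bsub>?P\<^esub> h) (snd d) = finsum R ?F (B d)" .
    qed (auto intro!: R.finsum_closed simp: f g h carr multc A_def B_def)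
    finally show "((f \<otimes>\<^bsub>?P\<^esub> g) \<otimes>\<^bsub>?P\<^esub> h) p = (f \<otimes>\<^bsub>?P\<^esub> (g \<otimes>\<^bsub>?P\<^esub> h)) p" .
  qed
  have single: "(\<Oplus>d\<in>?D p. F d) = F d0"
    if "d0 \<in> ?D p" "F d0 \<in> carrier R" "\<And>d. d \<in> ?D p \<Longrightarrow> d \<noteq> d0 \<Longrightarrow> F d = \<zero>" for p d0 F
  proof -
    have "(\<Oplus>d\<in>?D p. F d) = (\<Oplus>d\<in>?D p. if d0 = d then F d else \<zero>)"
      by (rule R.finsum_cong') (use that(1,2) that(3)[OF _ not_sym] in auto)
    also have "\<dots> = F d0"
    proof (rule R.finsum_singleton[OF that(1) finD])
      show "F \<in> ?D p \<rightarrow> carrier R"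
      proof
        fix d assume "d \<in> ?D p"
        thus "F d \<in> carrier R" using that(2) that(3)[of d] by (cases "d = d0") simp_all
      qed
    qed
    finally show ?thesis .
  qed
  have lone: "\<one>\<^bsub>?P\<^esub> \<otimes>\<^bsub>?P\<^esub> f = f" if f: "f \<in> carrier ?P" for f
  proof
    fix p
    show "(\<one>\<^bsub>?P\<^esub> \<otimes>\<^bsub>?P\<^esub> f) p = f p"
    proof (cases "p \<in> paths Q")
      case True
      have v: "path_head p \<in> verts Q" using path_ends_in_verts[OF Q True] by simp
      have "(\<one>\<^bsub>?P\<^esub> \<otimes>\<^bsub>?P\<^esub> f) p = \<one>\<^bsub>?P\<^esub> (trivial_path (path_head p)) \<otimes> f p"
        unfolding mult
      proof (subst single[of "(trivial_path (path_head p), p)"])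
        fix d assume d: "d \<in> ?D p" "d \<noteq> (trivial_path (path_head p), p)"
        have "fst d \<notin> trivial_path ` verts Q"
          using d by (cases d) (auto simp: decompositions_def)
        thus "\<one>\<^bsub>?P\<^esub> (fst d) \<otimes> f (snd d) = \<zero>" using carr[OF f] by (simp add: one)
      qed (auto simp: decompositions_def one v True trivial_path_in_paths[OF Q] carr[OF f])
      thus ?thesis using v carr[OF f] by (simp add: one)
    qed (use supp f multc onec in metis)
  qed
  have rone: "f \<otimes>\<^bsub>?P\<^esub> \<one>\<^bsub>?P\<^esub> = f" if f: "f \<in> carrier ?P" for f
  proof
    fix p
    show "(f \<otimes>\<^bsub>?P\<^esub> \<one>\<^bsub>?P\<^esub>) p = f p"
    proof (cases "p \<in> paths Q")
      case True
      have v: "path_tail p \<in> verts Q" using path_ends_in_verts[OF Q True] by simp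
      have "(f \<otimes>\<^bsub>?P\<^esub> \<one>\<^bsub>?P\<^esub>) p = f p \<otimes> \<one>\<^bsub>?P\<^esub> (trivial_path (path_tail p))"
        unfolding mult
      proof (subst single[of "(p, trivial_path (path_tail p))"])
        fix d assume d: "d \<in> ?D p" "d \<noteq> (p, trivial_path (path_tail p))"
        have "snd d \<notin> trivial_path ` verts Q"
        proof
          assume "snd d \<in> trivial_path ` verts Q"
          then obtain v where v: "snd d = trivial_path v" by auto
          with d have "path_tail (fst d) = v" by (auto simp: decompositions_def)
          with v d show False
            by (cases d) (auto simp: decompositions_def)
        qed
        thus "f (fst d) \<otimes> \<one>\<^bsub>?P\<^esub> (snd d) = \<zero>" using carr[OF f] by (simp add: one)
      qed (auto simp: decompositions_def one v True trivial_path_in_paths[OF Q] carr[OF f])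
      thus ?thesis using v carr[OF f] by (simp add: one)
    qed (use supp f multc onec in metis)
  qed
  have mon: "monoid ?P"
    by (rule monoidI) (use multc onec assoc lone rone in auto)
  show ?thesis
  proof (rule ringI[OF abel mon])
    fix x y z assume c: "x \<in> carrier ?P" "y \<in> carrier ?P" "z \<in> carrier ?P"
    show "(x \<oplus>\<^bsub>?P\<^esub> y) \<otimes>\<^bsub>?P\<^esub> z = x \<otimes>\<^bsub>?P\<^esub> z \<oplus>\<^bsub>?P\<^esub> y \<otimes>\<^bsub>?P\<^esub> z"
      by (rule ext, simp only: add mult, subst R.finsum_addf[symmetric])
        (auto intro!: R.finsum_cong' simp: R.l_distr c carr)
    show "z \<otimes>\<^bsub>?P\<^esub> (x \<oplus>\<^bsub>?P\<^esub> y) = z \<otimes>\<^bsub>?P\<^esub> x \<oplus>\<^bsub>?P\<^esub> z \<otimes>\<^bsub>?P\<^esub> y"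
      by (rule ext, simp only: add mult, subst R.finsum_addf[symmetric])
        (auto intro!: R.finsum_cong' simp: R.r_distr c carr)
  qed
qed

lemma path_elem_closed:
  assumes "ring R" "p \<in> paths Q"
  shows "path_elem R p \<in> carrier (path_algebra R Q)"
proof -
  interpret ring R by fact
  have "{q. path_elem R p q \<noteq> \<zero>\<^bsub>R\<^esub>} \<subseteq> {p}" by (auto simp: path_elem_def)
  thus ?thesis using assms(2) finite_subset
    by (fastforce simp: path_algebra_def path_elem_def)
qed

lemma path_elem_mult:
  assumes "ring R" "fin_digraph Q" "p \<in> paths Q" "q \<in> paths Q"
  shows "path_elem R p \<otimes>\<^bsub>path_algebra R Q\<^esub> path_elem R q =
    (if path_tail p = path_head q then path_elem R (path_comp p q) else \<zero>\<^bsub>path_algebra R Q\<^esub>)"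
proof -
  interpret ring R by fact
  have "finsum R (\<lambda>(s, t). path_elem R p s \<otimes>\<^bsub>R\<^esub> path_elem R q t) (decompositions Q x) =
      (if (p, q) \<in> decompositions Q x then \<one>\<^bsub>R\<^esub> else \<zero>\<^bsub>R\<^esub>)" for x
  proof -
    have "finsum R (\<lambda>(s, t). path_elem R p s \<otimes>\<^bsub>R\<^esub> path_elem R q t) (decompositions Q x) =
        finsum R (\<lambda>d. if (p, q) = d then \<one>\<^bsub>R\<^esub> else \<zero>\<^bsub>R\<^esub>) (decompositions Q x)"
      by (rule finsum_cong') (auto simp: path_elem_def split: if_splits)
    also have "\<dots> = (if (p, q) \<in> decompositions Q x then \<one>\<^bsub>R\<^esub> else \<zero>\<^bsub>R\<^esub>)"
    proof (cases "(p, q) \<in> decompositions Q x")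
      case True
      thus ?thesis
        using finsum_singleton[of "(p, q)" "decompositions Q x" "\<lambda>_. \<one>\<^bsub>R\<^esub>"]
          finite_decompositions[OF assms(2)] by simp
    next
      case False
      have "finsum R (\<lambda>d. if (p, q) = d then \<one>\<^bsub>R\<^esub> else \<zero>\<^bsub>R\<^esub>) (decompositions Q x) = \<zero>\<^bsub>R\<^esub>"
        by (rule add.finprod_one_eqI) (use False in auto)
      thus ?thesis using False by simp
    qed
    finally show ?thesis .
  qed
  thus ?thesis using assms(3,4)
    by (auto simp: path_algebra_def decompositions_def path_elem_def fun_eq_iff)
qed

definition paths_of_length ::
    "('r, 'x) ring_scheme \<Rightarrow> ('v, 'a) pre_digraph \<Rightarrow> nat \<Rightarrow> (('v, 'a) path \<Rightarrow> 'r) set" where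
  "paths_of_length R Q l =
     {f \<in> carrier (path_algebra R Q). \<forall>p\<in>paths Q. f p \<noteq> \<zero>\<^bsub>R\<^esub> \<longrightarrow> path_length p = l}"

definition arrow_ideal ::
    "('r, 'x) ring_scheme \<Rightarrow> ('v, 'a) pre_digraph \<Rightarrow> (('v, 'a) path \<Rightarrow> 'r) set" where
  "arrow_ideal R Q =
     {f \<in> carrier (path_algebra R Q). \<forall>p\<in>paths Q. f p \<noteq> \<zero>\<^bsub>R\<^esub> \<longrightarrow> path_length p \<ge> 1}"

definition coefficients_in ::
    "('r, 'x) ring_scheme \<Rightarrow> 'r set \<Rightarrow> ('v, 'a) pre_digraph \<Rightarrow> (('v, 'a) path \<Rightarrow> 'r) set" where
  "coefficients_in R \<mm> Q = {f \<in> carrier (path_algebra R Q). \<forall>p\<in>paths Q. f p \<in> \<mm>}"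


section \<open>Quotients of the path algebra\<close>

definition admissible ::
    "('r, 'x) ring_scheme \<Rightarrow> ('v, 'a) pre_digraph \<Rightarrow> (('v, 'a) path \<Rightarrow> 'r) set \<Rightarrow>
     ('v, 'a) path \<Rightarrow> bool" where
  "admissible R Q I p \<longleftrightarrow> p \<in> paths Q \<and> path_elem R p \<notin> I"

definition path_coset ::
    "('r, 'x) ring_scheme \<Rightarrow> ('v, 'a) pre_digraph \<Rightarrow> (('v, 'a) path \<Rightarrow> 'r) set \<Rightarrow>
     ('v, 'a) path \<Rightarrow> (('v, 'a) path \<Rightarrow> 'r) set" where
  "path_coset R Q I p = I +>\<^bsub>path_algebra R Q\<^esub> path_elem R p"

text \<open>With \<open>\<Lambda>\<close> the quotient by \<open>I\<close>, these are the modules \<open>\<Lambda>p\<close> and \<open>p\<Lambda>\<close>.\<close>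

definition left_path_module ::
    "('r, 'x) ring_scheme \<Rightarrow> ('v, 'a) pre_digraph \<Rightarrow> (('v, 'a) path \<Rightarrow> 'r) set \<Rightarrow>
     ('v, 'a) path \<Rightarrow> (('v, 'a) path \<Rightarrow> 'r) set set" where
  "left_path_module R Q I p = left_cyclic (path_algebra R Q Quot I) (path_coset R Q I p)"

definition right_path_module ::
    "('r, 'x) ring_scheme \<Rightarrow> ('v, 'a) pre_digraph \<Rightarrow> (('v, 'a) path \<Rightarrow> 'r) set \<Rightarrow>
     ('v, 'a) path \<Rightarrow> (('v, 'a) path \<Rightarrow> 'r) set set" where
  "right_path_module R Q I p = right_cyclic (path_algebra R Q Quot I) (path_coset R Q I p)"

definition arrow_radical ::
    "('r, 'x) ring_scheme \<Rightarrow> ('v, 'a) pre_digraph \<Rightarrow> (('v, 'a) path \<Rightarrow> 'r) set \<Rightarrow> bool" where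
  "arrow_radical R Q I \<longleftrightarrow>
     (let \<Lambda> = path_algebra R Q Quot I;
          \<Lambda>_left = left_path_module R Q I;
          \<Lambda>_right = right_path_module R Q I
      in \<forall>v\<in>verts Q.
           left_local \<Lambda> (\<Lambda>_left (trivial_path v)) \<and>
           left_rad \<Lambda> (\<Lambda>_left (trivial_path v)) =
             family_sum \<Lambda> (\<lambda>c. \<Lambda>_left (arrow_path Q c)) {c \<in> arcs Q. tail Q c = v} \<and>
           right_local \<Lambda> (\<Lambda>_right (trivial_path v)) \<and>
           right_rad \<Lambda> (\<Lambda>_right (trivial_path v)) =
             family_sum \<Lambda> (\<lambda>c. \<Lambda>_right (arrow_path Q c)) {c \<in> arcs Q. head Q c = v})"

definition bounded_below ::
    "('r, 'x) ring_scheme \<Rightarrow> 'r set \<Rightarrow> ('v, 'a) pre_digraph \<Rightarrow> (('v, 'a) path \<Rightarrow> 'r) set \<Rightarrow> bool"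
  where
  "bounded_below R \<mm> Q I \<longleftrightarrow>
     (\<exists>m n :: nat. m > 0 \<and> n > 0 \<and>
        ideal_power (path_algebra R Q) (arrow_ideal R Q) m
          \<subseteq> I <+>\<^bsub>path_algebra R Q\<^esub> coefficients_in R \<mm> Q \<and>
        coefficients_in R \<mm> Q
          \<subseteq> I <+>\<^bsub>path_algebra R Q\<^esub> family_sum (path_algebra R Q) (paths_of_length R Q) {1..n})"

definition special ::
    "('r, 'x) ring_scheme \<Rightarrow> ('v, 'a) pre_digraph \<Rightarrow> (('v, 'a) path \<Rightarrow> 'r) set \<Rightarrow> bool" where
  "special R Q I \<longleftrightarrow>
     (let xy_notin_I = (\<lambda>x y. path_elem R (arrow_path Q x) \<otimes>\<^bsub>path_algebra R Q\<^esub>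
                              path_elem R (arrow_path Q y) \<notin> I)
      in \<forall>y\<in>arcs Q.
           (\<forall>x\<in>arcs Q. \<forall>x'\<in>arcs Q.
              tail Q x = head Q y \<and> xy_notin_I x y \<and>
              tail Q x' = head Q y \<and> xy_notin_I x' y \<longrightarrow> x = x') \<and>
           (\<forall>z\<in>arcs Q. \<forall>z'\<in>arcs Q.
              head Q z = tail Q y \<and> xy_notin_I y z \<and>
              head Q z' = tail Q y \<and> xy_notin_I y z' \<longrightarrow> z = z'))"

end

theory Submission
  imports Defs
begin

text \<open>
  For an admissible non-trivial path \<open>p\<close> the module \<open>\<Lambda>p\<close> is a non-zero quotient of the local module
  \<open>\<Lambda>e\<^sub>v\<close>, where \<open>v\<close> is the head of \<open>p\<close>, so its unique maximal submodule is the sum of the \<open>\<Lambda>cp\<close>.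
  As \<open>I\<close> is special, at most one \<open>cp\<close> is admissible.  Hence a non-zero submodule \<open>N\<close> of \<open>\<Lambda>p\<close> is either
  some \<open>\<Lambda>q\<close> with \<open>q\<close> extending \<open>p\<close>, or it lies in the intersection \<open>K\<close> of an infinite chain
  \<open>\<Lambda>p\<^sub>0 \<supset> \<Lambda>p\<^sub>1 \<supset> \<dots>\<close> with \<open>p\<^sub>0 = p\<close>.  In the latter case, boundedness from below gives \<open>K = rK\<close> for
  some \<open>r\<close> in the maximal ideal and makes \<open>\<Lambda>\<close> a noetherian \<open>R\<close>-module, so that \<open>K = 0\<close>.  Admissible
  paths with a common right arrow extend one another, and the inclusions are strict, so \<open>\<Lambda>p\<close>
  determines \<open>p\<close>.  The statements for right modules are those for the opposite ring.
\<close>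

section \<open>Cyclic modules and their radicals\<close>

text \<open>The chain of extensions need not stop: over a discrete valuation ring \<open>R\<close>
  with uniformizer \<open>t\<close>, the quiver with one loop \<open>x\<close> and the ideal
  generated by \<open>x - t\<close> give \<open>\<Lambda> = R\<close> and
  \<open>\<Lambda>x\<^sup>n = t\<^sup>nR\<close>. Hence an intersection argument is unavoidable, and
  since \<open>\<Lambda>\<close> is noncommutative in general it has to be moved from paths to
  central scalars. The two inclusions of \<open>bounded_below\<close> serve this in different ways.
  The one for \<open>A\<^sup>m\<close> rewrites every long path with coefficients in
  \<open>\<mm>\<close>; it provides the scalar \<open>r\<close>, because if all scalars from
  \<open>\<mm>\<close> carried \<open>p\<close> into \<open>K\<close>, then so would all long paths.
  The one for \<open>\<mm>Q\<close> then rewrites such an element with paths of bounded length, so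
  finitely many paths span \<open>\<Lambda>\<close> over \<open>R\<close>. The passage from modules
  to paths is made for an arbitrary ring with an abstract extension relation on indices, so that
  \<open>\<Lambda>\<close> and its opposite ring are two instances of one argument.\<close>

context ring
begin

lemma left_submoduleI:
  assumes "N \<subseteq> M" "M \<subseteq> carrier R" "\<zero> \<in> N"
    and "\<And>x y. x \<in> N \<Longrightarrow> y \<in> N \<Longrightarrow> x \<oplus> y \<in> N"
    and "\<And>l x. l \<in> carrier R \<Longrightarrow> x \<in> N \<Longrightarrow> l \<otimes> x \<in> N"
  shows "left_submodule R M N"
proof -
  \<comment> \<open>Negation is the action of \<open>\<ominus> \<one>\<close>.\<close>
  have "\<ominus> x \<in> N" if "x \<in> N" for x
    using assms(5)[of "\<ominus> \<one>" x] that assms(1,2) l_minus[of \<one> x] by auto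
  hence "subgroup N (add_monoid R)"
    using assms by (intro add.subgroupI) auto
  thus ?thesis using assms by (simp add: left_submodule_def additive_subgroup_def)
qed

lemma left_submoduleD:
  assumes "left_submodule R M N"
  shows "N \<subseteq> M" "N \<subseteq> carrier R" "\<zero> \<in> N"
    and "\<And>x y. x \<in> N \<Longrightarrow> y \<in> N \<Longrightarrow> x \<oplus> y \<in> N"
    and "\<And>l x. l \<in> carrier R \<Longrightarrow> x \<in> N \<Longrightarrow> l \<otimes> x \<in> N"
proof -
  have N: "additive_subgroup N R" using assms by (simp add: left_submodule_def)
  show "N \<subseteq> M" "\<And>l x. l \<in> carrier R \<Longrightarrow> x \<in> N \<Longrightarrow> l \<otimes> x \<in> N"
    using assms by (simp_all add: left_submodule_def)
  show "N \<subseteq> carrier R" "\<zero> \<in> N" "\<And>x y. x \<in> N \<Longrightarrow> y \<in> N \<Longrightarrow> x \<oplus> y \<in> N"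
    using additive_subgroup.a_subset[OF N] additive_subgroup.zero_closed[OF N]
      additive_subgroup.a_closed[OF N] by simp_all
qed

lemma left_submodule_finsum:
  assumes "left_submodule R M N" "\<And>i. i \<in> C \<Longrightarrow> f i \<in> N"
  shows "finsum R f C \<in> N"
  using assms(2) left_submoduleD[OF assms(1)]
  by (induction C rule: infinite_finite_induct) (auto simp: finsum_insert subset_iff Pi_iff)

lemma left_submodule_mono:
  assumes "left_submodule R M N" "N \<subseteq> M'"
  shows "left_submodule R M' N"
  using assms by (simp add: left_submodule_def)

lemma left_cyclicI [intro]: "l \<in> carrier R \<Longrightarrow> l \<otimes> x \<in> left_cyclic R x"
  by (auto simp: left_cyclic_def)

lemma left_cyclic_self [simp]: "x \<in> carrier R \<Longrightarrow> x \<in> left_cyclic R x"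
  using left_cyclicI[of \<one> x] by simp

lemma left_cyclic_carrier: "x \<in> carrier R \<Longrightarrow> left_cyclic R x \<subseteq> carrier R"
  by (auto simp: left_cyclic_def)

lemma left_cyclic_submodule:
  assumes "x \<in> carrier R"
  shows "left_submodule R (carrier R) (left_cyclic R x)"
proof (rule left_submoduleI)
  show "\<zero> \<in> left_cyclic R x" using left_cyclicI[of \<zero> x] assms by simp
  show "y \<oplus> z \<in> left_cyclic R x" if yz: "y \<in> left_cyclic R x" "z \<in> left_cyclic R x" for y z
  proof -
    obtain k l where "k \<in> carrier R" "l \<in> carrier R" "y = k \<otimes> x" "z = l \<otimes> x"
      using yz by (auto simp: left_cyclic_def)
    thus ?thesis using left_cyclicI[of "k \<oplus> l" x] assms by (simp add: l_distr)
  qed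
  show "l \<otimes> y \<in> left_cyclic R x" if l: "l \<in> carrier R" and y: "y \<in> left_cyclic R x" for l y
  proof -
    obtain k where "k \<in> carrier R" "y = k \<otimes> x" using y by (auto simp: left_cyclic_def)
    thus ?thesis using l left_cyclicI[of "l \<otimes> k" x] assms by (simp add: m_assoc)
  qed
qed (use left_cyclic_carrier[OF assms] in auto)

lemma left_cyclic_least:
  assumes "left_submodule R M N" "x \<in> N"
  shows "left_cyclic R x \<subseteq> N"
  using left_submoduleD(5)[OF assms(1)] assms(2) by (auto simp: left_cyclic_def)

lemma left_cyclic_mono:
  assumes "x \<in> left_cyclic R y" "y \<in> carrier R"
  shows "left_cyclic R x \<subseteq> left_cyclic R y"
  using left_cyclic_least[OF left_cyclic_submodule] assms by blast

text \<open>The generator detects properness: a submodule is proper exactly if it omits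
  \<open>e\<close>. The union of a chain of submodules omitting \<open>e\<close> omits
  \<open>e\<close> as well, so Zorn's lemma applies.\<close>

lemma proper_submodule_subset_maximal:
  assumes e: "e \<in> carrier R" and N: "left_submodule R (left_cyclic R e) N"
    and "N \<noteq> left_cyclic R e"
  shows "\<exists>K. maximal_left_submodule R (left_cyclic R e) K \<and> N \<subseteq> K"
proof -
  let ?M = "left_cyclic R e"
  have proper: "e \<notin> K \<longleftrightarrow> K \<noteq> ?M" if "left_submodule R ?M K" for K
    using left_submoduleD(1)[OF that] left_cyclic_least[OF that] left_cyclic_self[OF e] by auto
  define \<A> where "\<A> = {K. left_submodule R ?M K \<and> N \<subseteq> K \<and> e \<notin> K}"
  have "\<exists>K\<in>\<A>. \<forall>K'\<in>\<A>. K \<subseteq> K' \<longrightarrow> K' = K"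
  proof (rule subset_Zorn_nonempty)
    show "\<A> \<noteq> {}" using N assms(3) proper[OF N] by (auto simp: \<A>_def)
    fix C assume C: "C \<noteq> {}" "subset.chain \<A> C"
    have sub: "left_submodule R ?M K" "N \<subseteq> K" "e \<notin> K" if "K \<in> C" for K
      using C(2) that by (auto simp: subset_chain_def \<A>_def)
    have "left_submodule R ?M (\<Union>C)"
    proof (rule left_submoduleI[OF _ left_cyclic_carrier[OF e]])
      show "\<Union>C \<subseteq> ?M" using left_submoduleD(1)[OF sub(1)] by blast
      show "\<zero> \<in> \<Union>C" using left_submoduleD(3)[OF sub(1)] C(1) by blast
      show "x \<oplus> y \<in> \<Union>C" if xy: "x \<in> \<Union>C" "y \<in> \<Union>C" for x y
      proof -
        obtain K K' where K: "K \<in> C" "x \<in> K" "K' \<in> C" "y \<in> K'" using xy by blast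
        moreover have "K \<subseteq> K' \<or> K' \<subseteq> K" using C(2) K(1,3) by (simp add: subset_chain_def)
        ultimately obtain K where "K \<in> C" "x \<in> K" "y \<in> K" by blast
        thus ?thesis using left_submoduleD(4)[OF sub(1)] by blast
      qed
      show "l \<otimes> x \<in> \<Union>C" if "l \<in> carrier R" "x \<in> \<Union>C" for l x
        using that left_submoduleD(5)[OF sub(1)] by blast
    qed
    moreover have "N \<subseteq> \<Union>C" "e \<notin> \<Union>C" using sub(2,3) C(1) by blast+
    ultimately show "\<Union>C \<in> \<A>" by (simp add: \<A>_def)
  qed
  then obtain K where K: "K \<in> \<A>" and max: "\<And>K'. K' \<in> \<A> \<Longrightarrow> K \<subseteq> K' \<Longrightarrow> K' = K" by blast
  have "maximal_left_submodule R ?M K"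
    unfolding maximal_left_submodule_def
  proof (intro conjI allI impI)
    show "left_submodule R ?M K" "K \<noteq> ?M" using K proper by (auto simp: \<A>_def)
    fix N' assume N': "left_submodule R ?M N' \<and> K \<subseteq> N'"
    show "N' = K \<or> N' = ?M"
    proof (cases "e \<in> N'")
      case True
      thus ?thesis using proper N' by blast
    next
      case False
      hence "N' \<in> \<A>" using K N' by (auto simp: \<A>_def)
      thus ?thesis using max N' by blast
    qed
  qed
  thus ?thesis using K by (auto simp: \<A>_def)
qed

text \<open>Locality makes the intersection defining the radical run over a single maximal
  submodule, and by Zorn's lemma every submodule omitting the generator lies in it. This is the only
  way locality is used later.\<close>

lemma left_local_rad:
  assumes e: "e \<in> carrier R" and "left_local R (left_cyclic R e)"
  shows "left_submodule R (left_cyclic R e) (left_rad R (left_cyclic R e))"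
    and "e \<notin> left_rad R (left_cyclic R e)"
    and "\<And>N. left_submodule R (left_cyclic R e) N \<Longrightarrow> e \<notin> N \<Longrightarrow> N \<subseteq> left_rad R (left_cyclic R e)"
proof -
  let ?M = "left_cyclic R e"
  obtain K where K: "maximal_left_submodule R ?M K"
    and uniq: "\<And>K'. maximal_left_submodule R ?M K' \<Longrightarrow> K' = K"
    using assms(2) by (auto simp: left_local_def)
  have sub: "left_submodule R ?M K" "K \<noteq> ?M" using K by (auto simp: maximal_left_submodule_def)
  have "{N. maximal_left_submodule R ?M N} = {K}" using K uniq by blast
  hence rad: "left_rad R ?M = K"
    using left_submoduleD(1)[OF sub(1)] by (auto simp: left_rad_def)
  show "left_submodule R ?M (left_rad R ?M)" using sub(1) rad by simp
  show "e \<notin> left_rad R ?M"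
    using left_cyclic_least[OF sub(1)] left_submoduleD(1)[OF sub(1)] sub(2) rad by blast
  fix N assume N: "left_submodule R ?M N" "e \<notin> N"
  have "N \<noteq> ?M" using N(2) left_cyclic_self[OF e] by blast
  thus "N \<subseteq> left_rad R ?M"
    using proper_submodule_subset_maximal[OF e N(1)] uniq rad by blast
qed

text \<open>Serves twice: as the preimage, under right multiplication by \<open>y\<close>, of a
  submodule \<open>N\<close> of the cyclic module of \<open>y\<close>, and with
  \<open>N = {\<zero>}\<close> as the annihilator of \<open>y\<close>.\<close>

lemma left_annihilator_quotient_submodule:
  assumes N: "left_submodule R M N" and "e \<in> carrier R" "y \<in> carrier R"
  shows "left_submodule R (left_cyclic R e) {l \<in> left_cyclic R e. l \<otimes> y \<in> N}"
proof (rule left_submoduleI[OF _ left_cyclic_carrier])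
  note D = left_submoduleD[OF left_cyclic_submodule[OF assms(2)]]
  note DN = left_submoduleD[OF N]
  show "\<zero> \<in> {l \<in> left_cyclic R e. l \<otimes> y \<in> N}" using D(3) DN(3) assms by simp
  show "k \<oplus> l \<in> {l \<in> left_cyclic R e. l \<otimes> y \<in> N}"
    if "k \<in> {l \<in> left_cyclic R e. l \<otimes> y \<in> N}" "l \<in> {l \<in> left_cyclic R e. l \<otimes> y \<in> N}" for k l
    using that D DN assms by (auto simp: l_distr subset_iff)
  show "k \<otimes> l \<in> {l \<in> left_cyclic R e. l \<otimes> y \<in> N}"
    if "k \<in> carrier R" "l \<in> {l \<in> left_cyclic R e. l \<otimes> y \<in> N}" for k l
    using that D DN assms by (auto simp: m_assoc subset_iff)
qed (use assms in auto)

text \<open>Since \<open>e \<otimes> y = y\<close>, right multiplication by \<open>y\<close> maps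
  the cyclic module of \<open>e\<close> onto that of \<open>y\<close>, and the preimage of the
  proper submodule \<open>N\<close> omits \<open>e\<close>. So this preimage lies in the radical,
  and \<open>N\<close> lies in the sum of the cyclic modules of the \<open>x c \<otimes> y\<close>.
  As \<open>N\<close> is nonzero, some summand is nonzero, and \<open>unique\<close> leaves just
  that one.\<close>

lemma proper_submodule_of_local_image:
  assumes e: "e \<in> carrier R" "left_local R (left_cyclic R e)"
    and rad: "left_rad R (left_cyclic R e) = family_sum R (\<lambda>c. left_cyclic R (x c)) C"
    and x: "\<And>c. c \<in> C \<Longrightarrow> x c \<in> carrier R"
    and y: "y \<in> carrier R" "e \<otimes> y = y"
    and N: "left_submodule R (left_cyclic R y) N" "N \<noteq> left_cyclic R y" "N \<noteq> {\<zero>}"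
    and unique: "\<And>c c'. \<lbrakk>c \<in> C; c' \<in> C; x c \<otimes> y \<noteq> \<zero>; x c' \<otimes> y \<noteq> \<zero>\<rbrakk> \<Longrightarrow> c = c'"
  shows "\<exists>c\<in>C. x c \<otimes> y \<noteq> \<zero> \<and> N \<subseteq> left_cyclic R (x c \<otimes> y)"
proof -
  have "y \<notin> N"
    using left_cyclic_least[OF N(1)] left_submoduleD(1)[OF N(1)] N(2) by blast
  hence sub: "{l \<in> left_cyclic R e. l \<otimes> y \<in> N} \<subseteq> left_rad R (left_cyclic R e)"
    by (intro left_local_rad(3)[OF e] left_annihilator_quotient_submodule[OF N(1) e(1) y(1)])
      (simp add: y(2))
  have repr: "\<exists>u. (\<forall>c\<in>C. u c \<in> left_cyclic R (x c \<otimes> y)) \<and> n = finsum R u C" if n: "n \<in> N" for n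
  proof -
    obtain l where l: "l \<in> carrier R" "n = l \<otimes> y"
      using n left_submoduleD(1)[OF N(1)] by (auto simp: left_cyclic_def)
    \<comment> \<open>Replacing \<open>l\<close> by \<open>l \<otimes> e\<close> keeps the product
      with \<open>y\<close> and moves the multiplier into the cyclic module of
      \<open>e\<close>.\<close>
    have ly: "(l \<otimes> e) \<otimes> y = n" using l e(1) y by (simp add: m_assoc)
    hence "l \<otimes> e \<in> family_sum R (\<lambda>c. left_cyclic R (x c)) C"
      using sub n left_cyclicI[OF l(1), of e] rad by blast
    then obtain u where u: "\<And>c. c \<in> C \<Longrightarrow> u c \<in> left_cyclic R (x c)" "l \<otimes> e = finsum R u C"
      by (auto simp: family_sum_def)
    have uc: "u c \<in> carrier R" if "c \<in> C" for c
      using u(1)[OF that] left_cyclic_carrier[OF x[OF that]] by blast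
    show ?thesis
    proof (cases "finite C")
      case True
      have "n = (\<Oplus>c\<in>C. u c \<otimes> y)"
        using finsum_ldistr[OF True y(1), of u] uc ly u(2) by auto
      moreover have "u c \<otimes> y \<in> left_cyclic R (x c \<otimes> y)" if "c \<in> C" for c
        using u(1)[OF that] x[OF that] y(1)
        by (auto simp: left_cyclic_def m_assoc)
      ultimately show ?thesis by (intro exI[of _ "\<lambda>c. u c \<otimes> y"]) auto
    next
      case False
      \<comment> \<open>Over an infinite index set \<open>finsum\<close> is zero by
        convention.\<close>
      hence "n = \<zero>" using ly u(2) y(1) by (simp add: finsum_infinite)
      moreover have "\<zero> \<in> left_cyclic R (x c \<otimes> y)" if "c \<in> C" for c
        using left_submoduleD(3)[OF left_cyclic_submodule] x[OF that] y(1) by simp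
      ultimately show ?thesis using False
        by (intro exI[of _ "\<lambda>_. \<zero>"]) (auto simp: finsum_infinite)
    qed
  qed
  have zero: "left_cyclic R \<zero> = {\<zero>}"
    by (auto simp: left_cyclic_def intro!: exI[of _ \<zero>])
  have "\<exists>c\<in>C. x c \<otimes> y \<noteq> \<zero>"
  proof (rule ccontr)
    assume *: "\<not> ?thesis"
    have "n = \<zero>" if n: "n \<in> N" for n
    proof -
      obtain u where u: "\<forall>c\<in>C. u c \<in> left_cyclic R (x c \<otimes> y)" "n = finsum R u C"
        using repr[OF n] by blast
      have "\<forall>c\<in>C. u c = \<zero>" using u(1) * zero by auto
      thus ?thesis unfolding u(2) by (intro add.finprod_one_eqI) auto
    qed
    thus False using N(3) left_submoduleD(3)[OF N(1)] by blast
  qed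
  then obtain c where c: "c \<in> C" "x c \<otimes> y \<noteq> \<zero>" by blast
  have sc: "left_submodule R (carrier R) (left_cyclic R (x c \<otimes> y))"
    using left_cyclic_submodule x[OF c(1)] y(1) by simp
  have "N \<subseteq> left_cyclic R (x c \<otimes> y)"
  proof
    fix n assume "n \<in> N"
    then obtain u where u: "\<forall>c\<in>C. u c \<in> left_cyclic R (x c \<otimes> y)" "n = finsum R u C"
      using repr by blast
    show "n \<in> left_cyclic R (x c \<otimes> y)"
      unfolding u(2)
    proof (rule left_submodule_finsum[OF sc])
      fix c' assume c': "c' \<in> C"
      show "u c' \<in> left_cyclic R (x c \<otimes> y)"
        using u(1) c' unique[OF c(1) c' c(2)] zero left_submoduleD(3)[OF sc]
        by (cases "x c' \<otimes> y = \<zero>") auto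
    qed
  qed
  thus ?thesis using c by blast
qed

lemma family_sum_member:
  assumes "c \<in> C" "finite C" "z \<in> left_cyclic R (x c)"
    and "\<And>c. c \<in> C \<Longrightarrow> x c \<in> carrier R"
  shows "z \<in> family_sum R (\<lambda>c. left_cyclic R (x c)) C"
proof -
  have z: "z \<in> carrier R" using assms left_cyclic_carrier by blast
  have "finsum R (\<lambda>d. if c = d then z else \<zero>) C = z"
    using finsum_singleton[of c C "\<lambda>_. z"] assms z by simp
  moreover have "(if c = d then z else \<zero>) \<in> left_cyclic R (x d)" if "d \<in> C" for d
    using assms(1,3) left_submoduleD(3)[OF left_cyclic_submodule[OF assms(4)[OF that]]] by auto
  ultimately show ?thesis
    unfolding family_sum_def by (intro CollectI exI[of _ "\<lambda>d. if c = d then z else \<zero>"]) auto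
qed

text \<open>A Nakayama argument. If \<open>y = l \<otimes> (x c \<otimes> y)\<close>, then
  \<open>z = e \<ominus> l \<otimes> x c\<close> annihilates \<open>y\<close>. The annihilator omits
  \<open>e\<close> because \<open>y \<noteq> \<zero>\<close>, so \<open>z\<close> lies in the
  radical. So does \<open>l \<otimes> x c\<close>, and their sum \<open>e\<close> would
  follow.\<close>

lemma left_cyclic_strict_in_local_image:
  assumes e: "e \<in> carrier R" "left_local R (left_cyclic R e)"
    and rad: "left_rad R (left_cyclic R e) = family_sum R (\<lambda>c. left_cyclic R (x c)) C"
    and x: "\<And>c. c \<in> C \<Longrightarrow> x c \<in> carrier R"
    and C: "finite C" "c \<in> C" "x c \<otimes> e = x c"
    and y: "y \<in> carrier R" "e \<otimes> y = y" "y \<noteq> \<zero>"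
  shows "y \<notin> left_cyclic R (x c \<otimes> y)"
proof
  assume "y \<in> left_cyclic R (x c \<otimes> y)"
  then obtain l where l: "l \<in> carrier R" "y = l \<otimes> (x c \<otimes> y)" by (auto simp: left_cyclic_def)
  let ?M = "left_cyclic R e"
  have M: "left_submodule R (carrier R) ?M" by (rule left_cyclic_submodule[OF e(1)])
  note xc = x[OF C(2)]
  have zero: "left_submodule R (carrier R) {\<zero>}"
    by (rule left_submoduleI) auto
  define z where "z = e \<ominus> l \<otimes> x c"
  have lx: "l \<otimes> x c \<in> ?M"
    using left_cyclicI[of "l \<otimes> x c" e] l(1) xc e(1) C(3) by (simp add: m_assoc)
  have zy: "z \<otimes> y = \<zero>"
  proof -
    have "z \<otimes> y = e \<otimes> y \<ominus> l \<otimes> (x c \<otimes> y)"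
      unfolding z_def using l(1) xc e(1) y(1)
      by (simp add: minus_eq l_distr l_minus m_assoc)
    thus ?thesis using l(2) y by simp
  qed
  have "z \<in> ?M"
    unfolding z_def minus_eq
  proof (rule left_submoduleD(4)[OF M left_cyclic_self[OF e(1)]])
    show "\<ominus> (l \<otimes> x c) \<in> ?M"
      using left_submoduleD(5)[OF M _ lx, of "\<ominus> \<one>"] l(1) xc by (simp add: l_minus)
  qed
  hence "z \<in> {l \<in> ?M. l \<otimes> y \<in> {\<zero>}}" using zy by simp
  moreover have "e \<notin> {l \<in> ?M. l \<otimes> y \<in> {\<zero>}}" using y by simp
  ultimately have "z \<in> left_rad R ?M"
    using left_local_rad(3)[OF e left_annihilator_quotient_submodule[OF zero e(1) y(1)]] by blast
  moreover have "l \<otimes> x c \<in> left_rad R ?M"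
    unfolding rad by (rule family_sum_member[OF C(2,1)]) (use l x in auto)
  ultimately have "z \<oplus> l \<otimes> x c \<in> left_rad R ?M"
    by (rule left_submoduleD(4)[OF left_local_rad(1)[OF e]])
  moreover have "z \<oplus> l \<otimes> x c = e"
    unfolding z_def using e(1) l(1) xc by (simp add: minus_eq a_assoc l_neg)
  ultimately show False using left_local_rad(2)[OF e] by simp
qed

end

section \<open>Chains of cyclic modules\<close>

text \<open>
  \<open>E\<close> is the extension of an admissible path by one arrow, \<open>el\<close> the coset of a path and \<open>S\<close> the image
  of the maximal ideal in \<open>\<Lambda>\<close>.  Only \<open>divisible\<close> and \<open>deep\<close> depend on boundedness from below; the latter
  says that long extensions of \<open>p\<close> lie in \<open>S\<Lambda>p\<close>.
\<close>

locale uniserial_chain = ring L for L (structure) +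
  fixes X :: "'p set" and E :: "'p \<Rightarrow> 'p \<Rightarrow> bool" and el :: "'p \<Rightarrow> 'a" and S :: "'a set"
  assumes el_closed: "p \<in> X \<Longrightarrow> el p \<in> carrier L"
    and step_in: "p \<in> X \<Longrightarrow> E p q \<Longrightarrow> q \<in> X"
    and step_cyclic: "p \<in> X \<Longrightarrow> E p q \<Longrightarrow> el q \<in> left_cyclic L (el p)"
    and step_strict: "p \<in> X \<Longrightarrow> E p q \<Longrightarrow> el p \<notin> left_cyclic L (el q)"
    and step_unique: "p \<in> X \<Longrightarrow> E p q \<Longrightarrow> E p q' \<Longrightarrow> q = q'"
    and descend: "\<lbrakk>p \<in> X; left_submodule L (left_cyclic L (el p)) N; N \<noteq> left_cyclic L (el p);
      N \<noteq> {\<zero>}\<rbrakk> \<Longrightarrow> \<exists>q. E p q \<and> N \<subseteq> left_cyclic L (el q)"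
    and scalars: "S \<subseteq> carrier L"
    and central: "s \<in> S \<Longrightarrow> x \<in> carrier L \<Longrightarrow> s \<otimes> x = x \<otimes> s"
    and divisible: "\<lbrakk>\<And>i::nat. z i \<in> carrier L; s \<in> S; \<And>i. z i = s \<otimes> z (Suc i)\<rbrakk> \<Longrightarrow> z 0 = \<zero>"
    and deep: "p \<in> X \<Longrightarrow> \<exists>M. \<forall>q N. (E ^^ M) p q \<longrightarrow> left_submodule L (carrier L) N \<longrightarrow>
      (\<forall>s\<in>S. s \<otimes> el p \<in> N) \<longrightarrow> el q \<in> N"
begin

section \<open>Iterated extensions and their cyclic modules\<close>

lemma steps_in: "E\<^sup>*\<^sup>* p q \<Longrightarrow> p \<in> X \<Longrightarrow> q \<in> X"
  by (induction rule: rtranclp_induct) (auto intro: step_in)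

lemma steps_mono: "E\<^sup>*\<^sup>* p q \<Longrightarrow> p \<in> X \<Longrightarrow> left_cyclic L (el q) \<subseteq> left_cyclic L (el p)"
proof (induction rule: rtranclp_induct)
  case (step q r)
  have q: "q \<in> X" using steps_in step by blast
  show ?case
    using left_cyclic_mono[OF step_cyclic[OF q step(2)] el_closed[OF q]] step by blast
qed simp

text \<open>Steps are deterministic, so everything reached from \<open>a\<close> lies on a single
  line.\<close>

lemma steps_comparable:
  assumes "E\<^sup>*\<^sup>* a p" "E\<^sup>*\<^sup>* a q" "a \<in> X"
  shows "E\<^sup>*\<^sup>* p q \<or> E\<^sup>*\<^sup>* q p"
  using assms
proof (induction rule: rtranclp_induct)
  case (step p p')
  have p: "p \<in> X" using steps_in step by blast
  consider "E\<^sup>*\<^sup>* p q" | "E\<^sup>*\<^sup>* q p" using step by blast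
  thus ?case
  proof cases
    case 1
    thus ?thesis
    proof (cases rule: converse_rtranclpE)
      case base
      thus ?thesis using step(2) by blast
    next
      case (step r)
      thus ?thesis using step_unique[OF p] \<open>E p p'\<close> by blast
    qed
  next
    case 2
    thus ?thesis using step(2) by (meson rtranclp.rtrancl_into_rtrancl)
  qed
qed simp

text \<open>Were there a first step from \<open>p\<close> to some \<open>r\<close>, the module of
  \<open>q\<close> would lie in that of \<open>r\<close>, which already omits
  \<open>el p\<close>.\<close>

lemma steps_antisym:
  assumes "E\<^sup>*\<^sup>* p q" "p \<in> X" "left_cyclic L (el p) = left_cyclic L (el q)"
  shows "p = q"
  using assms(1)
proof (cases rule: converse_rtranclpE)
  case (step r)
  have "left_cyclic L (el q) \<subseteq> left_cyclic L (el r)"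
    using steps_mono[OF step(2)] step_in[OF assms(2) step(1)] by blast
  thus ?thesis
    using step_strict[OF assms(2) step(1)] left_cyclic_self[OF el_closed[OF assms(2)]] assms(3)
    by blast
qed simp

lemma cyclic_determines:
  assumes "E\<^sup>*\<^sup>* a p" "E\<^sup>*\<^sup>* a q" "a \<in> X" "left_cyclic L (el p) = left_cyclic L (el q)"
  shows "p = q"
  using steps_comparable[OF assms(1-3)] steps_antisym[of p q] steps_antisym[of q p]
    steps_in[OF assms(1,3)] steps_in[OF assms(2,3)] assms(4) by metis

text \<open>
  Let \<open>K\<close> be the intersection of an infinite chain of modules \<open>\<Lambda>p\<^sub>i\<close>.  Some scalar \<open>r\<close> in the
  maximal ideal has \<open>r p\<^sub>0\<close> outside \<open>K\<close>; then no \<open>r p\<^sub>j\<close> lies in \<open>K\<close>, since the preimage under \<open>r\<close>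
  of the maximal submodule of \<open>\<Lambda>r p\<^sub>j\<close> is a proper submodule of \<open>\<Lambda>p\<^sub>j\<close>.  Hence \<open>K = rK\<close>, so that
  every element of \<open>K\<close> is infinitely divisible by \<open>r\<close>.
\<close>

lemma infinite_chain_intersection:
  assumes f0: "f 0 \<in> X" and fS: "\<And>i. E (f i) (f (Suc i))"
    and x: "\<And>i. x \<in> left_cyclic L (el (f i))"
  shows "x = \<zero>"
proof -
  define P where "P i = el (f i)" for i
  define M where "M i = left_cyclic L (P i)" for i
  define K where "K = (\<Inter>i. M i)"
  have X: "f i \<in> X" for i
    by (induction i) (use f0 fS step_in in auto)
  have Pc [simp]: "P i \<in> carrier L" for i using el_closed X by (simp add: P_def)
  have sub: "left_submodule L (carrier L) (M i)" for i
    unfolding M_def by (rule left_cyclic_submodule) simp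
  note subD = left_submoduleD[OF sub]
  have Kc: "K \<subseteq> carrier L" using subD(2) by (auto simp: K_def)
  have K: "left_submodule L (carrier L) K"
    by (rule left_submoduleI) (use subD Kc in \<open>auto simp: K_def\<close>)
  note KD = left_submoduleD[OF K]
  have PM: "P i \<in> M i" for i by (simp add: M_def)
  have PS: "P (Suc i) \<in> M i" for i
    using step_cyclic[OF X fS] by (simp add: M_def P_def)
  have PnS: "P i \<notin> M (Suc i)" for i
    using step_strict[OF X fS] by (simp add: M_def P_def)
  have PnK: "P i \<notin> K" for i using PnS by (auto simp: K_def)
  \<comment> \<open>Since steps are unique, the index supplied by \<open>descend\<close> is the next
    member of the chain.\<close>
  have desc: "N \<subseteq> M (Suc i)" if "left_submodule L (M i) N" "N \<noteq> M i" "N \<noteq> {\<zero>}" for N i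
    using descend[OF X, of i N] that step_unique[OF X fS] by (auto simp: M_def P_def)
  have dec: "M i \<subseteq> M 0" for i
  proof (induction i)
    case (Suc i)
    have "M (Suc i) \<subseteq> M i" unfolding M_def[of "Suc i"]
      by (rule left_cyclic_least[OF sub PS])
    thus ?case using Suc by blast
  qed simp
  \<comment> \<open>Take the last \<open>j\<close> with \<open>y \<in> M j\<close>. The cyclic
    module of \<open>y\<close> is a nonzero submodule of \<open>M j\<close> not inside
    \<open>M (Suc j)\<close>, so by \<open>desc\<close> it is all of \<open>M j\<close>.\<close>
  have hit: "\<exists>j. left_cyclic L y = M j" if y: "y \<in> M 0" "y \<notin> K" for y
  proof -
    define i where "i = (LEAST i. y \<notin> M i)"
    have "\<exists>i. y \<notin> M i" using y(2) by (auto simp: K_def)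
    hence i: "y \<notin> M i" unfolding i_def by (rule LeastI_ex)
    then obtain j where j: "i = Suc j" using y(1) by (cases i) auto
    have yj: "y \<in> M j" using not_less_Least[of j "\<lambda>i. y \<notin> M i"] j unfolding i_def by auto
    have yc: "y \<in> carrier L" using y(1) subD(2) by blast
    have "left_submodule L (M j) (left_cyclic L y)"
      using left_submodule_mono[OF left_cyclic_submodule[OF yc] left_cyclic_least[OF sub yj]] .
    moreover have "left_cyclic L y \<noteq> {\<zero>}" using y(2) KD(3) left_cyclic_self[OF yc] by auto
    ultimately show ?thesis
      using desc[of j "left_cyclic L y"] i left_cyclic_self[OF yc] unfolding j by blast
  qed
  \<comment> \<open>Otherwise \<open>deep\<close>, applied to the submodule \<open>K\<close>, would
    put some \<open>P n\<close> into \<open>K\<close>, although \<open>P n\<close> is already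
    missing from \<open>M (Suc n)\<close>.\<close>
  obtain r where r: "r \<in> S" "r \<otimes> P 0 \<notin> K"
  proof (rule ccontr)
    assume *: "\<not> thesis"
    obtain n where n: "\<forall>q N. (E ^^ n) (f 0) q \<longrightarrow> left_submodule L (carrier L) N \<longrightarrow>
      (\<forall>s\<in>S. s \<otimes> el (f 0) \<in> N) \<longrightarrow> el q \<in> N"
      using deep[OF f0] by blast
    have "(E ^^ k) (f 0) (f k)" for k
      by (induction k) (use fS in auto)
    hence "P n \<in> K" using n K * that by (auto simp: P_def)
    thus False using PnK by blast
  qed
  have rc: "r \<in> carrier L" using r(1) scalars by blast
  have swap: "r \<otimes> (l \<otimes> y) = l \<otimes> (r \<otimes> y)" if "l \<in> carrier L" "y \<in> carrier L" for l y
    using that rc central[OF r(1), of l] by (simp add: m_assoc[symmetric])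
  have rK: "r \<otimes> P j \<notin> K" for j
  proof (induction j)
    case (Suc j)
    show ?case
    proof
      assume *: "r \<otimes> P (Suc j) \<in> K"
      have "r \<otimes> P j \<in> M 0" using subD(5)[OF rc PM] dec by blast
      then obtain i where i: "left_cyclic L (r \<otimes> P j) = M i" using hit Suc by blast
      define N where "N = {y \<in> M j. r \<otimes> y \<in> M (Suc i)}"
      have "left_submodule L (M j) N"
        by (rule left_submoduleI) (use subD rc in \<open>auto simp: N_def r_distr swap subset_iff\<close>)
      moreover have "N \<noteq> M j"
      proof
        assume "N = M j"
        hence "r \<otimes> P j \<in> M (Suc i)" using PM by (auto simp: N_def)
        hence "M i \<subseteq> M (Suc i)" using left_cyclic_least[OF sub] i by blast
        thus False using PnS PM by blast
      qed
      \<comment> \<open>The element \<open>l \<otimes> P j\<close> witnesses that \<open>N\<close>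
        is nonzero, since \<open>r\<close> sends it to \<open>P (Suc i)\<close>. Once
        \<open>N\<close> is known to lie in \<open>M (Suc j)\<close>, the same element makes
        \<open>P (Suc i)\<close> a multiple of \<open>r \<otimes> P (Suc j)\<close>, which was
        assumed to be in \<open>K\<close>.\<close>
      moreover obtain l where l: "l \<in> carrier L" "P (Suc i) = l \<otimes> (r \<otimes> P j)"
        using PS[of i] unfolding i[symmetric] by (auto simp: left_cyclic_def)
      have y: "l \<otimes> P j \<in> N" "r \<otimes> (l \<otimes> P j) = P (Suc i)"
        using l PM[of "Suc i"] subD(5)[OF l(1) PM] by (simp_all add: N_def swap)
      have "N \<noteq> {\<zero>}"
      proof
        assume "N = {\<zero>}"
        hence "P (Suc i) = \<zero>" using y rc by simp
        thus False using PnK KD(3) by metis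
      qed
      ultimately have "l \<otimes> P j \<in> M (Suc j)" using desc y(1) by blast
      then obtain k where k: "k \<in> carrier L" "l \<otimes> P j = k \<otimes> P (Suc j)"
        by (auto simp: M_def left_cyclic_def)
      have "P (Suc i) = k \<otimes> (r \<otimes> P (Suc j))" using y(2) k by (simp add: swap)
      thus False using KD(5)[OF k(1) *] PnK by metis
    qed
  qed (use r in simp)
  obtain i where i: "left_cyclic L (r \<otimes> P 0) = M i"
    using hit[OF subD(5)[OF rc PM] rK] by blast
  have div: "\<exists>y\<in>K. z = r \<otimes> y" if z: "z \<in> K" for z
  proof -
    have "z \<in> left_cyclic L (r \<otimes> P 0)" using z i by (auto simp: K_def)
    then obtain l where l: "l \<in> carrier L" "z = l \<otimes> (r \<otimes> P 0)" by (auto simp: left_cyclic_def)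
    have lM: "l \<otimes> P 0 \<in> M 0" by (rule subD(5)[OF l(1) PM])
    have zl: "z = r \<otimes> (l \<otimes> P 0)" using l by (simp add: swap)
    \<comment> \<open>Outside \<open>K\<close> this element would generate some \<open>M j\<close>.
      Then \<open>P j\<close> would be a multiple of it, and \<open>r \<otimes> P j\<close> a
      multiple of \<open>z\<close>, hence in \<open>K\<close>.\<close>
    have "l \<otimes> P 0 \<in> K"
    proof (rule ccontr)
      assume "l \<otimes> P 0 \<notin> K"
      then obtain j where j: "left_cyclic L (l \<otimes> P 0) = M j" using hit lM by blast
      then obtain k where k: "k \<in> carrier L" "P j = k \<otimes> (l \<otimes> P 0)"
        using PM[of j] by (auto simp: left_cyclic_def)
      have "r \<otimes> P j = k \<otimes> z" unfolding k(2) zl using k(1) l(1) by (simp add: swap)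
      thus False using rK KD(5)[OF k(1) z] by metis
    qed
    thus ?thesis using zl by blast
  qed
  \<comment> \<open>Choosing for each element of \<open>K\<close> a quotient by \<open>r\<close>
    inside \<open>K\<close> gives a self-map of \<open>K\<close>; its iterates at \<open>x\<close>
    are the sequence fed to \<open>divisible\<close>.\<close>
  then obtain g where g: "\<And>z. z \<in> K \<Longrightarrow> g z \<in> K" "\<And>z. z \<in> K \<Longrightarrow> z = r \<otimes> g z" by metis
  have xK: "x \<in> K" using x by (auto simp: K_def M_def P_def)
  have gK: "(g ^^ i) x \<in> K" for i by (induction i) (use xK g in auto)
  have "(g ^^ 0) x = \<zero>"
  proof (rule divisible[OF _ r(1)])
    show "(g ^^ i) x \<in> carrier L" for i using gK Kc by blast
    show "(g ^^ i) x = r \<otimes> (g ^^ Suc i) x" for i using g(2)[OF gK] by simp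
  qed
  thus "x = \<zero>" by simp
qed

text \<open>If \<open>N\<close> is none of the cyclic modules along the way, \<open>descend\<close>
  applies at every index reached, and dependent choice assembles an infinite chain whose modules all
  contain \<open>N\<close>.\<close>

theorem submodules_of_cyclic:
  assumes p: "p \<in> X" and N: "left_submodule L (left_cyclic L (el p)) N" "N \<noteq> {\<zero>}"
  shows "\<exists>q. E\<^sup>*\<^sup>* p q \<and> N = left_cyclic L (el q)"
proof (rule ccontr)
  assume *: "\<not> ?thesis"
  have next_step: "\<exists>q'. (E\<^sup>*\<^sup>* p q' \<and> N \<subseteq> left_cyclic L (el q')) \<and> E q q'"
    if q: "E\<^sup>*\<^sup>* p q \<and> N \<subseteq> left_cyclic L (el q)" for q
  proof -
    have "q \<in> X" using steps_in q p by blast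
    moreover have "left_submodule L (left_cyclic L (el q)) N"
      using left_submodule_mono[OF N(1)] q by blast
    ultimately obtain q' where "E q q'" "N \<subseteq> left_cyclic L (el q')"
      using descend N(2) * q by blast
    thus ?thesis using q by (meson rtranclp.rtrancl_into_rtrancl)
  qed
  have "\<exists>f. \<forall>i. (E\<^sup>*\<^sup>* p (f i) \<and> N \<subseteq> left_cyclic L (el (f i))) \<and> E (f i) (f (Suc i))"
    using dependent_nat_choice[of "\<lambda>_ q. E\<^sup>*\<^sup>* p q \<and> N \<subseteq> left_cyclic L (el q)" "\<lambda>_. E"]
      next_step left_submoduleD(1)[OF N(1)] by blast
  then obtain f where f: "\<And>i. E\<^sup>*\<^sup>* p (f i)" "\<And>i. N \<subseteq> left_cyclic L (el (f i))"
    "\<And>i. E (f i) (f (Suc i))" by blast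
  have "x = \<zero>" if "x \<in> N" for x
    using infinite_chain_intersection[of f x] f steps_in[OF f(1) p] that by blast
  thus False using N(2) left_submoduleD(3)[OF N(1)] by blast
qed

end

section \<open>Functions with values in a noetherian ring\<close>

text \<open>Noetherian modules enter only through submodules of the free module of functions on \<open>T\<close>.\<close>

definition function_submodule :: "('r, 'x) ring_scheme \<Rightarrow> 'b set \<Rightarrow> ('b \<Rightarrow> 'r) set \<Rightarrow> bool" where
  "function_submodule R T M \<longleftrightarrow>
     (\<forall>f\<in>M. range f \<subseteq> carrier R \<and> (\<forall>p. p \<notin> T \<longrightarrow> f p = \<zero>\<^bsub>R\<^esub>)) \<and>
     (\<lambda>_. \<zero>\<^bsub>R\<^esub>) \<in> M \<and>
     (\<forall>f\<in>M. \<forall>g\<in>M. (\<lambda>p. f p \<oplus>\<^bsub>R\<^esub> g p) \<in> M) \<and>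
     (\<forall>r\<in>carrier R. \<forall>f\<in>M. (\<lambda>p. r \<otimes>\<^bsub>R\<^esub> f p) \<in> M)"

context noetherian_ring
begin

text \<open>By the ascending chain condition the union is itself a member, and every later member
  lies between that one and the union.\<close>

lemma ideal_chain_stationary:
  assumes ideal: "\<And>i. ideal (J i) R" and chain: "\<And>i. J i \<subseteq> J (Suc i)"
  shows "\<exists>k. \<forall>i\<ge>k. J i = J k"
proof -
  have mono: "J i \<subseteq> J j" if "i \<le> j" for i j
    by (rule lift_Suc_mono_le[of J, OF chain that])
  have "\<Union>(range J) \<in> range J"
  proof (rule ideal_chain_is_trivial)
    show "subset.chain {I. ideal I R} (range J)"
      unfolding subset_chain_def using ideal mono by (auto simp: image_iff) (metis nle_le subsetD)
  qed simp
  then obtain k where k: "\<Union>(range J) = J k" by blast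
  have "J i = J k" if "k \<le> i" for i
    using mono[OF that] k by blast
  thus ?thesis by blast
qed

text \<open>Finite free modules over a noetherian ring are noetherian. Splitting off a coordinate
  \<open>t\<close> leaves the members vanishing at \<open>t\<close>, covered by induction, and the
  ideal of values at \<open>t\<close>. Once both chains are constant, an element \<open>f\<close> of
  a late member differs from some \<open>g\<close> of the earlier one, chosen with the same value at
  \<open>t\<close>, by an element vanishing at \<open>t\<close>.\<close>

lemma function_submodule_chain_stationary:
  fixes M :: "nat \<Rightarrow> ('p \<Rightarrow> 'a) set"
  assumes "cring R" "finite T" "\<And>i. function_submodule R T (M i)" "\<And>i. M i \<subseteq> M (Suc i)"
  shows "\<exists>k. \<forall>i\<ge>k. M i = M k"
  using assms(2-)
proof (induction T arbitrary: M rule: finite_induct)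
  case empty
  have "M i = {\<lambda>_. \<zero>}" for i
    using empty(1)[of i] by (fastforce simp: function_submodule_def)
  thus ?case by simp
next
  case (insert t T)
  interpret cring R by fact
  have fin: "range f \<subseteq> carrier R" "f p \<in> carrier R" "p \<notin> insert t T \<Longrightarrow> f p = \<zero>"
    if "f \<in> M i" for f i p
    using insert(4)[of i] that by (auto simp: function_submodule_def)
  have zero: "(\<lambda>_. \<zero>) \<in> M i" for i using insert(4)[of i] by (simp add: function_submodule_def)
  have add: "(\<lambda>p. f p \<oplus> g p) \<in> M i" if "f \<in> M i" "g \<in> M i" for f g i
    using insert(4)[of i] that by (simp add: function_submodule_def)
  have smult: "(\<lambda>p. r \<otimes> f p) \<in> M i" if "r \<in> carrier R" "f \<in> M i" for r f i
    using insert(4)[of i] that by (simp add: function_submodule_def)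
  have mono: "M i \<subseteq> M j" if "i \<le> j" for i j
    by (rule lift_Suc_mono_le[of M, OF insert(5) that])
  define N where "N i = {f \<in> M i. f t = \<zero>}" for i
  define J where "J i = (\<lambda>f. f t) ` M i" for i
  have outside: "f p = \<zero>" if "f \<in> M i" "f t = \<zero>" "p \<notin> T" for f i p
    using fin(3)[OF that(1), of p] that(2,3) by (cases "p = t") simp_all
  have "function_submodule R T (N i)" for i
    unfolding function_submodule_def N_def
    using fin(1)[of _ i] outside[of _ i] zero add smult by simp
  moreover have "N i \<subseteq> N (Suc i)" for i using insert(5) by (auto simp: N_def)
  ultimately obtain k where k: "\<And>i. i \<ge> k \<Longrightarrow> N i = N k" using insert.IH[of N] by blast
  have "ideal (J i) R" for i
  proof (rule idealI[OF ring_axioms])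
    have addJ: "x \<oplus> y \<in> J i" if xy: "x \<in> J i" "y \<in> J i" for x y
    proof -
      obtain f g where "f \<in> M i" "g \<in> M i" "x = f t" "y = g t" using xy by (auto simp: J_def)
      thus ?thesis using add[of f i g] by (auto simp: J_def intro!: image_eqI)
    qed
    have lJ: "r \<otimes> x \<in> J i" if r: "r \<in> carrier R" and x: "x \<in> J i" for r x
    proof -
      obtain f where "f \<in> M i" "x = f t" using x by (auto simp: J_def)
      thus ?thesis using smult[OF r, of f i] by (auto simp: J_def intro!: image_eqI)
    qed
    have zJ: "\<zero> \<in> J i" using zero[of i] by (auto simp: J_def intro!: image_eqI)
    have cJ: "J i \<subseteq> carrier R" using fin(2) by (auto simp: J_def)
    have "left_submodule R (carrier R) (J i)"
      by (rule left_submoduleI) (use addJ lJ zJ cJ in auto)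
    thus "subgroup (J i) (add_monoid R)"
      by (simp add: left_submodule_def additive_subgroup_def)
    show "r \<otimes> x \<in> J i" if "x \<in> J i" "r \<in> carrier R" for r x using lJ that by blast
    show "x \<otimes> r \<in> J i" if "x \<in> J i" "r \<in> carrier R" for r x
      using lJ[OF that(2,1)] that cJ m_comm[of r x] by auto
  qed
  moreover have "J i \<subseteq> J (Suc i)" for i using insert(5) by (auto simp: J_def)
  ultimately obtain l where l: "\<And>i. i \<ge> l \<Longrightarrow> J i = J l" using ideal_chain_stationary by blast
  have "M i = M (max k l)" if i: "i \<ge> max k l" for i
  proof
    show "M (max k l) \<subseteq> M i" using mono i by blast
    show "M i \<subseteq> M (max k l)"
    proof
      fix f assume f: "f \<in> M i"
      have "f t \<in> J (max k l)" using f l[of i] l[of "max k l"] i by (auto simp: J_def)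
      then obtain g where g: "g \<in> M (max k l)" "f t = g t" by (auto simp: J_def)
      \<comment> \<open>The difference \<open>f - g\<close>, written with a scalar because
        \<open>function_submodule\<close> speaks of sums and scalar multiples.\<close>
      define h where "h = (\<lambda>p. f p \<oplus> \<ominus> \<one> \<otimes> g p)"
      have gi: "g \<in> M i" using g mono i by blast
      have "h \<in> M i" unfolding h_def by (rule add[OF f smult[OF _ gi]]) simp
      moreover have "h t = \<zero>"
        using g fin(2)[OF g(1), of t] by (simp add: h_def l_minus r_neg)
      ultimately have "h \<in> N i" by (simp add: N_def)
      hence "h \<in> M (max k l)" using k[of i] k[of "max k l"] i by (auto simp: N_def)
      hence "(\<lambda>p. h p \<oplus> g p) \<in> M (max k l)" by (rule add[OF _ g(1)])
      moreover have "(\<lambda>p. h p \<oplus> g p) = f"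
        using fin(2)[OF f] fin(2)[OF gi] by (auto simp: h_def l_minus a_assoc l_neg)
      ultimately show "f \<in> M (max k l)" by simp
    qed
  qed
  thus ?case by blast
qed

end

text \<open>If \<open>\<one> \<ominus> r\<close> generated a proper ideal, a maximal ideal would
  contain it. That ideal can only be \<open>\<mm>\<close>, which would then contain
  \<open>\<one>\<close> as the sum of \<open>\<one> \<ominus> r\<close> and
  \<open>r\<close>.\<close>

lemma local_ring_one_minus_unit:
  fixes R (structure)
  assumes "local_ring_with R \<mm>" "r \<in> \<mm>"
  shows "\<exists>u\<in>carrier R. u \<otimes> (\<one> \<ominus> r) = \<one>"
proof -
  interpret cring R using assms by (simp add: local_ring_with_def)
  have max: "maximalideal \<mm> R" and uniq: "\<And>J. maximalideal J R \<Longrightarrow> J = \<mm>"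
    using assms by (auto simp: local_ring_with_def)
  interpret m: maximalideal \<mm> R by (rule max)
  have r: "r \<in> carrier R" using assms(2) m.Icarr by blast
  \<comment> \<open>The whole ring is the cyclic module of \<open>\<one>\<close>, which makes the
    Zorn argument for cyclic modules available; in a commutative ring its left submodules are the
    ideals.\<close>
  have C1: "left_cyclic R \<one> = carrier R" 
    using left_cyclicI[of _ \<one>] left_cyclic_carrier[of \<one>] by force
  let ?N = "left_cyclic R (\<one> \<ominus> r)"
  have "?N = carrier R"
  proof (rule ccontr)
    assume "?N \<noteq> carrier R"
    then obtain K where K: "maximal_left_submodule R (carrier R) K" "?N \<subseteq> K"
      using proper_submodule_subset_maximal[of \<one> ?N] left_cyclic_submodule[of "\<one> \<ominus> r"] r C1
      by auto
    have Ks: "left_submodule R (carrier R) K" "K \<noteq> carrier R"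
      using K(1) by (auto simp: maximal_left_submodule_def)
    note KD = left_submoduleD[OF Ks(1)]
    have "maximalideal K R"
    proof (rule maximalidealI)
      show "ideal K R"
      proof (rule idealI[OF ring_axioms])
        show "subgroup K (add_monoid R)"
          using Ks(1) by (simp add: left_submodule_def additive_subgroup_def)
        show "l \<otimes> x \<in> K" if "x \<in> K" "l \<in> carrier R" for l x using KD(5) that by blast
        show "x \<otimes> l \<in> K" if "x \<in> K" "l \<in> carrier R" for l x
          using KD(5)[OF that(2,1)] that KD(2) m_comm[of l x] by auto
      qed
      show "carrier R \<noteq> K" using Ks(2) by simp
      fix J assume J: "ideal J R" "K \<subseteq> J" "J \<subseteq> carrier R"
      interpret J: ideal J R by fact
      have "left_submodule R (carrier R) J"
        using J(3) J.I_l_closed J.additive_subgroup_axioms by (simp add: left_submodule_def)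
      thus "J = K \<or> J = carrier R" using K(1) J(2) by (simp add: maximal_left_submodule_def)
    qed
    hence "K = \<mm>" by (rule uniq)
    moreover have "\<one> \<ominus> r \<in> K" using K(2) left_cyclic_self[of "\<one> \<ominus> r"] r by auto
    ultimately have "(\<one> \<ominus> r) \<oplus> r \<in> \<mm>" using assms(2) m.a_closed by blast
    moreover have "(\<one> \<ominus> r) \<oplus> r = \<one>" using r by (simp add: minus_eq a_assoc l_neg)
    ultimately show False using m.one_imp_carrier m.I_notcarr by simp
  qed
  hence "\<one> \<in> ?N" by simp
  then obtain u where "u \<in> carrier R" "\<one> = u \<otimes> (\<one> \<ominus> r)" by (auto simp: left_cyclic_def)
  thus ?thesis by metis
qed

section \<open>The path algebra and its quotients\<close>

locale quiver_algebra = cring R for R (structure) +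
  fixes Q :: "('v, 'e) pre_digraph"
  assumes quiver: "fin_digraph Q"
begin

abbreviation P where "P \<equiv> path_algebra R Q"

sublocale P: ring P
  using path_algebra_ring[OF ring_axioms quiver] .

lemma P_carrier: "f \<in> carrier P \<longleftrightarrow>
    (\<forall>p. f p \<in> carrier R) \<and> (\<forall>p. p \<notin> paths Q \<longrightarrow> f p = \<zero>) \<and> finite {p. f p \<noteq> \<zero>}"
  by (auto simp: path_algebra_def)

lemma P_add: "(f \<oplus>\<^bsub>P\<^esub> g) p = f p \<oplus> g p"
  by (simp add: path_algebra_def)

lemma P_zero: "\<zero>\<^bsub>P\<^esub> = (\<lambda>p. \<zero>)"
  by (simp add: path_algebra_def)

lemma P_mult: "(f \<otimes>\<^bsub>P\<^esub> g) p = (\<Oplus>d\<in>decompositions Q p. f (fst d) \<otimes> g (snd d))"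
  by (simp add: path_algebra_def case_prod_unfold)

text \<open>The \<open>R\<close>-module structure of the path algebra, as a separate operation
  because the record \<open>P\<close> carries only a ring structure.\<close>

definition smult :: "'a \<Rightarrow> (('v, 'e) path \<Rightarrow> 'a) \<Rightarrow> ('v, 'e) path \<Rightarrow> 'a" where
  "smult r f = (\<lambda>p. r \<otimes> f p)"

lemma smult_closed: "r \<in> carrier R \<Longrightarrow> f \<in> carrier P \<Longrightarrow> smult r f \<in> carrier P"
  unfolding P_carrier smult_def
  by (auto elim!: rev_finite_subset)

lemma smult_mult:
  assumes "r \<in> carrier R" "f \<in> carrier P" "g \<in> carrier P"
  shows "smult r f \<otimes>\<^bsub>P\<^esub> g = smult r (f \<otimes>\<^bsub>P\<^esub> g)" "f \<otimes>\<^bsub>P\<^esub> smult r g = smult r (f \<otimes>\<^bsub>P\<^esub> g)"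
proof -
  have c: "f p \<in> carrier R" "g p \<in> carrier R" for p using assms by (auto simp: P_carrier)
  show "smult r f \<otimes>\<^bsub>P\<^esub> g = smult r (f \<otimes>\<^bsub>P\<^esub> g)"
    by (rule ext) (simp add: P_mult smult_def finsum_rdistr[OF finite_decompositions[OF quiver] assms(1)]
        c m_assoc assms(1) Pi_def)
  show "f \<otimes>\<^bsub>P\<^esub> smult r g = smult r (f \<otimes>\<^bsub>P\<^esub> g)"
    by (rule ext) (simp add: P_mult smult_def finsum_rdistr[OF finite_decompositions[OF quiver] assms(1)]
        c m_lcomm assms(1) Pi_def)
qed

lemma smult_smult:
  "r \<in> carrier R \<Longrightarrow> s \<in> carrier R \<Longrightarrow> f \<in> carrier P \<Longrightarrow> smult r (smult s f) = smult (r \<otimes> s) f"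
  by (auto simp: smult_def P_carrier m_assoc)

lemma support_add:
  assumes "{p. f p \<noteq> \<zero>} \<subseteq> T" "{p. g p \<noteq> \<zero>} \<subseteq> T"
  shows "{p. (f \<oplus>\<^bsub>P\<^esub> g) p \<noteq> \<zero>} \<subseteq> T"
proof -
  have "(f \<oplus>\<^bsub>P\<^esub> g) p = \<zero>" if "p \<notin> T" for p
  proof -
    have "f p = \<zero>" "g p = \<zero>" using that assms by blast+
    thus ?thesis by (simp add: P_add)
  qed
  thus ?thesis by blast
qed

lemma support_smult:
  assumes "r \<in> carrier R" "{p. f p \<noteq> \<zero>} \<subseteq> T"
  shows "{p. smult r f p \<noteq> \<zero>} \<subseteq> T"
proof -
  have "smult r f p = \<zero>" if "p \<notin> T" for p
  proof -
    have "f p = \<zero>" using that assms(2) by blast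
    thus ?thesis using assms(1) by (simp add: smult_def)
  qed
  thus ?thesis by blast
qed

lemma smult_one: "f \<in> carrier P \<Longrightarrow> smult \<one> f = f"
  by (auto simp: smult_def P_carrier)

lemma smult_add_left: "r \<in> carrier R \<Longrightarrow> s \<in> carrier R \<Longrightarrow> f \<in> carrier P \<Longrightarrow>
    smult (r \<oplus> s) f = smult r f \<oplus>\<^bsub>P\<^esub> smult s f"
  by (rule ext) (simp add: smult_def P_add P_carrier l_distr)

lemma smult_zero_left: "f \<in> carrier P \<Longrightarrow> smult \<zero> f = \<zero>\<^bsub>P\<^esub>"
  by (rule ext) (simp add: smult_def P_zero P_carrier)

text \<open>The case \<open>path\<close> asks only for the terms of \<open>f\<close> itself, so that
  knowledge about the coefficients of \<open>f\<close>, such as membership in \<open>\<mm>\<close>,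
  can be used there. The induction runs over restrictions of \<open>f\<close> to finite sets of
  paths.\<close>

lemma path_algebra_induct [consumes 1, case_names zero add path]:
  assumes f: "f \<in> carrier P"
    and zero: "T \<zero>\<^bsub>P\<^esub>"
    and add: "\<And>g h. g \<in> carrier P \<Longrightarrow> h \<in> carrier P \<Longrightarrow> T g \<Longrightarrow> T h \<Longrightarrow> T (g \<oplus>\<^bsub>P\<^esub> h)"
    and path: "\<And>p. p \<in> paths Q \<Longrightarrow> T (smult (f p) (path_elem R p))"
  shows "T f"
proof -
  have fc: "f p \<in> carrier R" for p using f by (simp add: P_carrier)
  let ?r = "\<lambda>A p. if p \<in> A then f p else \<zero>"
  have "T (?r A) \<and> ?r A \<in> carrier P" if "finite A" "A \<subseteq> paths Q" for A
    using that
  proof (induction A rule: finite_induct)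
    case empty
    thus ?case using zero P.zero_closed by (simp add: P_zero)
  next
    case (insert p A)
    have pc: "smult (f p) (path_elem R p) \<in> carrier P"
      using insert(4) by (intro smult_closed path_elem_closed ring_axioms fc) simp
    have "?r (insert p A) = ?r A \<oplus>\<^bsub>P\<^esub> smult (f p) (path_elem R p)"
      by (rule ext) (use insert(2) fc in \<open>auto simp: P_add smult_def path_elem_def\<close>)
    thus ?case using insert(3,4) add[OF _ pc] path[of p] pc by simp
  qed
  from this[of "{p. f p \<noteq> \<zero>}"] have "T (?r {p. f p \<noteq> \<zero>})"
    using f by (auto simp: P_carrier)
  moreover have "?r {p. f p \<noteq> \<zero>} = f" by auto
  ultimately show ?thesis by simp
qed

abbreviation pe where "pe \<equiv> path_elem R"

lemma pe_closed [simp]: "p \<in> paths Q \<Longrightarrow> pe p \<in> carrier P"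
  by (rule path_elem_closed[OF ring_axioms])

lemma pe_comp: "p \<in> paths Q \<Longrightarrow> q \<in> paths Q \<Longrightarrow> path_tail p = path_head q \<Longrightarrow>
    pe (path_comp p q) = pe p \<otimes>\<^bsub>P\<^esub> pe q"
  by (simp add: path_elem_mult[OF ring_axioms quiver])

lemma comp_closed: "p \<in> paths Q \<Longrightarrow> q \<in> paths Q \<Longrightarrow> path_tail p = path_head q \<Longrightarrow>
    path_comp p q \<in> paths Q"
  using path_comp_in_paths[OF quiver] .

lemma ends_closed: "p \<in> paths Q \<Longrightarrow> path_tail p \<in> verts Q" "p \<in> paths Q \<Longrightarrow> path_head p \<in> verts Q"
  using path_ends_in_verts[OF quiver] by blast+

lemma arrow_path_in: "c \<in> arcs Q \<Longrightarrow> arrow_path Q c \<in> paths Q"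
proof -
  interpret fin_digraph Q by (rule quiver)
  show "c \<in> arcs Q \<Longrightarrow> arrow_path Q c \<in> paths Q"
    by (simp add: paths_def arrow_path_def awalk_Cons_iff awalk_Nil_iff)
qed

section \<open>Splitting paths and bounding their length\<close>

lemma path_first_arrow:
  assumes "p \<in> paths Q" "path_length p \<ge> 1"
  obtains p' c where "c \<in> arcs Q" "p' \<in> paths Q" "path_tail p' = head Q c"
    "p = path_comp p' (arrow_path Q c)" "path_length p = Suc (path_length p')" "right_arrow p = c"
proof -
  interpret fin_digraph Q by (rule quiver)
  obtain u as v where p: "p = Path u as v" by (cases p)
  obtain c as' where as: "as = c # as'" using assms(2) by (cases as) (auto simp: p path_length_def)
  have w: "c \<in> arcs Q" "u = tail Q c" "awalk (head Q c) as' v"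
    using assms(1) by (simp_all add: paths_def p as awalk_Cons_iff)
  show ?thesis
    by (rule that[of c "Path (head Q c) as' v"])
      (use w in \<open>simp_all add: paths_def path_comp_def arrow_path_def path_length_def right_arrow_def p as\<close>)
qed

lemma path_last_arrow:
  assumes "p \<in> paths Q" "path_length p \<ge> 1"
  obtains p' c where "c \<in> arcs Q" "p' \<in> paths Q" "path_head p' = tail Q c"
    "p = path_comp (arrow_path Q c) p'" "path_length p = Suc (path_length p')" "left_arrow p = c"
proof -
  interpret fin_digraph Q by (rule quiver)
  obtain u as v where p: "p = Path u as v" by (cases p)
  obtain c as' where as: "as = as' @ [c]"
    using assms(2) by (cases as rule: rev_cases) (auto simp: p path_length_def)
  have w: "awalk u (as' @ [c]) v" using assms(1) by (simp add: paths_def p as)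
  have w': "awalk u as' (tail Q c)" "c \<in> arcs Q" "v = head Q c"
    using awalk_append_iff[of u as' "[c]" v] w by (auto simp: awalk_Cons_iff awalk_Nil_iff)
  show ?thesis
    by (rule that[of c "Path u as' (tail Q c)"])
      (use w' in \<open>simp_all add: paths_def path_comp_def arrow_path_def path_length_def left_arrow_def p as\<close>)
qed

lemma trivial_path_unique:
  assumes "p \<in> paths Q" "path_length p = 0"
  shows "p = trivial_path (path_tail p)" "path_head p = path_tail p"
proof -
  interpret fin_digraph Q by (rule quiver)
  show "path_head p = path_tail p" "p = trivial_path (path_tail p)"
    using assms by (cases p; auto simp: paths_def path_length_def awalk_Nil_iff trivial_path_def)+
qed

lemma finite_short_paths: "finite {p \<in> paths Q. path_length p \<le> n}"
proof -
  interpret fin_digraph Q by (rule quiver)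
  let ?A = "(\<lambda>(u, as, v). Path u as v) `
    (verts Q \<times> {as. set as \<subseteq> arcs Q \<and> length as \<le> n} \<times> verts Q)"
  have "{p \<in> paths Q. path_length p \<le> n} \<subseteq> ?A"
  proof
    fix p assume p: "p \<in> {p \<in> paths Q. path_length p \<le> n}"
    hence "p = Path (path_tail p) (path_arrows p) (path_head p)" "set (path_arrows p) \<subseteq> arcs Q"
      "path_tail p \<in> verts Q" "path_head p \<in> verts Q" "length (path_arrows p) \<le> n"
      using ends_closed[of p] by (auto simp: paths_def path_length_def)
    thus "p \<in> ?A" by (intro image_eqI[where x = "(path_tail p, path_arrows p, path_head p)"]) auto
  qed
  moreover have "finite ?A"
    by (intro finite_imageI finite_cartesian_product finite_verts finite_lists_length_le finite_arcs)
  ultimately show ?thesis by (rule finite_subset)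
qed

text \<open>\<open>ideal_power\<close> takes each new factor on the right, so it is the right arrow,
  the first in the list, that is split off.\<close>

lemma long_path_in_ideal_power:
  assumes "p \<in> paths Q" "path_length p \<ge> n"
  shows "pe p \<in> ideal_power P (arrow_ideal R Q) n"
  using assms
proof (induction n arbitrary: p)
  case (Suc n)
  obtain p' c where p: "c \<in> arcs Q" "p' \<in> paths Q" "path_tail p' = head Q c"
    "p = path_comp p' (arrow_path Q c)" "path_length p = Suc (path_length p')"
    by (rule path_first_arrow[OF Suc.prems(1)]) (use Suc.prems(2) in auto)
  have "pe p = pe p' \<otimes>\<^bsub>P\<^esub> pe (arrow_path Q c)"
    unfolding p(4) using p arrow_path_in by (intro pe_comp) (simp_all add: arrow_path_def)
  moreover have "pe p' \<in> ideal_power P (arrow_ideal R Q) n" using Suc.IH[of p'] Suc.prems p by simp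
  moreover have "pe (arrow_path Q c) \<in> arrow_ideal R Q"
    using arrow_path_in[OF p(1)] pe_closed[of "arrow_path Q c"]
    by (auto simp: arrow_ideal_def path_elem_def path_length_def arrow_path_def)
  ultimately show ?case by (simp add: ideal_prod.prod)
qed simp

end

section \<open>The quotient as an algebra over \<open>R\<close>\<close>

locale quiver_quotient = quiver_algebra +
  fixes I
  assumes I: "ideal I P"
begin

sublocale I: ideal I P by (rule I)

abbreviation L where "L \<equiv> P Quot I"

sublocale L: ring L by (rule I.quotient_is_ring)

abbreviation pr where "pr f \<equiv> I +>\<^bsub>P\<^esub> f"

sublocale pr: ring_hom_ring P L "\<lambda>f. pr f"
  using I.rcos_ring_hom_ring .

lemma pr_surj:
  assumes "x \<in> carrier L"
  obtains f where "f \<in> carrier P" "x = pr f"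
proof -
  have "\<exists>f\<in>carrier P. x = pr f" using assms unfolding FactRing_simps by simp
  thus ?thesis using that by blast
qed

lemma pr_eq_zero: "f \<in> carrier P \<Longrightarrow> pr f = \<zero>\<^bsub>L\<^esub> \<longleftrightarrow> f \<in> I"
  unfolding FactRing_def using I.a_rcos_const I.a_rcos_self by auto

lemma pr_add_ideal: "i \<in> I \<Longrightarrow> f \<in> carrier P \<Longrightarrow> pr (i \<oplus>\<^bsub>P\<^esub> f) = pr f"
  using pr_eq_zero[of i] I.Icarr[of i] by simp

text \<open>The structure map from \<open>R\<close> into the centre of the quotient. It turns the
  action of scalars into multiplication by ring elements, the form in which
  \<open>uniserial_chain\<close> expects them.\<close>

definition sc where "sc r = pr (smult r \<one>\<^bsub>P\<^esub>)"

lemma sc_closed [simp]: "r \<in> carrier R \<Longrightarrow> sc r \<in> carrier L"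
  unfolding sc_def by (intro pr.hom_closed smult_closed) simp_all

lemma sc_mult:
  assumes "r \<in> carrier R" "f \<in> carrier P"
  shows "sc r \<otimes>\<^bsub>L\<^esub> pr f = pr (smult r f)" "pr f \<otimes>\<^bsub>L\<^esub> sc r = pr (smult r f)"
proof -
  have c: "smult r \<one>\<^bsub>P\<^esub> \<in> carrier P" using assms by (simp add: smult_closed)
  show "sc r \<otimes>\<^bsub>L\<^esub> pr f = pr (smult r f)"
    unfolding sc_def pr.hom_mult[OF c assms(2), symmetric] using assms by (simp add: smult_mult)
  show "pr f \<otimes>\<^bsub>L\<^esub> sc r = pr (smult r f)"
    unfolding sc_def pr.hom_mult[OF assms(2) c, symmetric] using assms by (simp add: smult_mult)
qed

lemma sc_central: "r \<in> carrier R \<Longrightarrow> x \<in> carrier L \<Longrightarrow> sc r \<otimes>\<^bsub>L\<^esub> x = x \<otimes>\<^bsub>L\<^esub> sc r"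
  by (elim pr_surj) (simp add: sc_mult)

lemma sc_sc: "r \<in> carrier R \<Longrightarrow> s \<in> carrier R \<Longrightarrow> sc r \<otimes>\<^bsub>L\<^esub> sc s = sc (r \<otimes> s)"
  unfolding sc_def[of s] sc_def[of "r \<otimes> s"]
  by (simp add: sc_mult smult_closed smult_smult)

lemma sc_one: "sc \<one> = \<one>\<^bsub>L\<^esub>"
  by (simp add: sc_def smult_one)

lemma sc_add: "r \<in> carrier R \<Longrightarrow> s \<in> carrier R \<Longrightarrow> sc (r \<oplus> s) = sc r \<oplus>\<^bsub>L\<^esub> sc s"
  by (simp add: sc_def smult_add_left smult_closed)

lemma sc_zero: "sc \<zero> = \<zero>\<^bsub>L\<^esub>"
  by (simp add: sc_def smult_zero_left)

text \<open>Takes the place of Nakayama's lemma for \<open>K = rK\<close>. Instead of generators of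
  \<open>K\<close> it follows one sequence of successive quotients, whose spans
  \<open>R x\<^sub>i\<close> ascend because each term is a multiple of the next. By
  \<open>gen\<close> the finite set \<open>T\<close> spans the quotient, so these spans can be
  compared through functions on \<open>T\<close>.\<close>

lemma infinitely_divisible_eq_zero:
  assumes local: "local_ring_with R \<mm>" and noeth: "noetherian_ring R"
    and T: "finite T" "T \<subseteq> paths Q"
    and gen: "\<And>f. f \<in> carrier P \<Longrightarrow> \<exists>g\<in>carrier P. {p. g p \<noteq> \<zero>} \<subseteq> T \<and> pr g = pr f"
    and x: "\<And>i::nat. x i \<in> carrier L" and r: "r \<in> \<mm>" and div: "\<And>i. x i = sc r \<otimes>\<^bsub>L\<^esub> x (Suc i)"
  shows "x 0 = \<zero>\<^bsub>L\<^esub>"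
proof -
  interpret m: ideal \<mm> R using local by (simp add: local_ring_with_def maximalideal_def)
  have rc: "r \<in> carrier R" using r m.Icarr by blast
  define M where "M i = {g \<in> carrier P. {p. g p \<noteq> \<zero>} \<subseteq> T \<and>
    (\<exists>s\<in>carrier R. pr g = sc s \<otimes>\<^bsub>L\<^esub> x i)}" for i
  have sub: "function_submodule R T (M i)" for i
    unfolding function_submodule_def
  proof (intro conjI ballI)
    show "(\<lambda>_. \<zero>) \<in> M i"
      unfolding M_def using P.zero_closed pr.hom_zero sc_zero x[of i]
      by (auto simp: P_zero intro!: bexI[of _ \<zero>])
    fix f assume f: "f \<in> M i"
    then obtain s where s: "s \<in> carrier R" "pr f = sc s \<otimes>\<^bsub>L\<^esub> x i" by (auto simp: M_def)
    have fP: "f \<in> carrier P" using f by (simp add: M_def)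
    show "range f \<subseteq> carrier R" "\<forall>p. p \<notin> T \<longrightarrow> f p = \<zero>"
      using f by (auto simp: M_def P_carrier)
    show "(\<lambda>p. f p \<oplus> g p) \<in> M i" if g: "g \<in> M i" for g
    proof -
      obtain t where t: "t \<in> carrier R" "pr g = sc t \<otimes>\<^bsub>L\<^esub> x i" using g by (auto simp: M_def)
      have gP: "g \<in> carrier P" using g by (simp add: M_def)
      have eq: "(\<lambda>p. f p \<oplus> g p) = f \<oplus>\<^bsub>P\<^esub> g" by (simp add: P_add fun_eq_iff)
      have "pr (f \<oplus>\<^bsub>P\<^esub> g) = sc (s \<oplus> t) \<otimes>\<^bsub>L\<^esub> x i"
        using s t fP gP x[of i] by (simp add: sc_add L.l_distr)
      moreover have "{p. (f \<oplus>\<^bsub>P\<^esub> g) p \<noteq> \<zero>} \<subseteq> T" using support_add f g by (simp add: M_def)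
      ultimately show ?thesis unfolding eq M_def using fP gP s(1) t(1) by auto
    qed
    show "(\<lambda>p. a \<otimes> f p) \<in> M i" if a: "a \<in> carrier R" for a
    proof -
      have "pr (smult a f) = sc (a \<otimes> s) \<otimes>\<^bsub>L\<^esub> x i"
        unfolding sc_mult(1)[OF a fP, symmetric] s(2) using a s(1) x[of i]
        by (simp add: sc_sc[symmetric] L.m_assoc)
      moreover have "{p. smult a f p \<noteq> \<zero>} \<subseteq> T" using support_smult[OF a] f by (simp add: M_def)
      moreover have "smult a f \<in> carrier P" using smult_closed[OF a fP] .
      ultimately show ?thesis unfolding M_def smult_def[symmetric] using a s(1) by auto
    qed
  qed
  \<comment> \<open>As \<open>M i\<close> is the preimage of \<open>R x\<^sub>i\<close>, stationarity gives \<open>x\<^sub>k\<^sub>+\<^sub>1 = s x\<^sub>k = s r x\<^sub>k\<^sub>+\<^sub>1\<close>, and \<open>1 - s r\<close> is a unit.\<close>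
  have "M i \<subseteq> M (Suc i)" for i
  proof
    fix f assume f: "f \<in> M i"
    then obtain s where s: "s \<in> carrier R" "pr f = sc s \<otimes>\<^bsub>L\<^esub> x i" by (auto simp: M_def)
    have "pr f = sc (s \<otimes> r) \<otimes>\<^bsub>L\<^esub> x (Suc i)"
      unfolding s(2) div[of i] using s(1) rc x by (simp add: sc_sc[symmetric] L.m_assoc)
    thus "f \<in> M (Suc i)" using f s(1) rc by (auto simp: M_def)
  qed
  then obtain k where k: "\<And>i. i \<ge> k \<Longrightarrow> M i = M k"
    using noetherian_ring.function_submodule_chain_stationary[OF noeth is_cring T(1), of M] sub
    by blast
  obtain f where "f \<in> carrier P" "x (Suc k) = pr f" using pr_surj[OF x] by blast
  then obtain g where g: "g \<in> carrier P" "{p. g p \<noteq> \<zero>} \<subseteq> T" "pr g = x (Suc k)"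
    using gen by metis
  have "g \<in> M (Suc k)"
    unfolding M_def using g sc_one x[of "Suc k"] by (auto intro!: bexI[of _ \<one>])
  hence "g \<in> M k" using k[of "Suc k"] by simp
  then obtain s where s: "s \<in> carrier R" "x (Suc k) = sc s \<otimes>\<^bsub>L\<^esub> x k"
    using g(3) by (auto simp: M_def)
  have xs: "x (Suc k) = sc (s \<otimes> r) \<otimes>\<^bsub>L\<^esub> x (Suc k)"
    using s(2) unfolding div[of k] using s(1) rc x by (simp add: sc_sc[symmetric] L.m_assoc)
  have srm: "s \<otimes> r \<in> \<mm>" using m.I_l_closed r s(1) by blast
  then obtain u where u: "u \<in> carrier R" "u \<otimes> (\<one> \<ominus> s \<otimes> r) = \<one>"
    using local_ring_one_minus_unit[OF local] by blast
  have "sc (\<one> \<ominus> s \<otimes> r) \<oplus>\<^bsub>L\<^esub> sc (s \<otimes> r) = \<one>\<^bsub>L\<^esub>"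
    using s(1) rc by (simp add: sc_add[symmetric] sc_one minus_eq a_assoc l_neg)
  hence "(sc (\<one> \<ominus> s \<otimes> r) \<oplus>\<^bsub>L\<^esub> sc (s \<otimes> r)) \<otimes>\<^bsub>L\<^esub> x (Suc k) = x (Suc k)" using x by simp
  hence "sc (\<one> \<ominus> s \<otimes> r) \<otimes>\<^bsub>L\<^esub> x (Suc k) \<oplus>\<^bsub>L\<^esub> x (Suc k) = x (Suc k)"
    using s(1) rc x[of "Suc k"] xs by (simp add: L.l_distr)
  hence "sc (\<one> \<ominus> s \<otimes> r) \<otimes>\<^bsub>L\<^esub> x (Suc k) = \<zero>\<^bsub>L\<^esub>"
    using s(1) rc x[of "Suc k"] L.add.l_cancel_one[of "x (Suc k)" "sc (\<one> \<ominus> s \<otimes> r) \<otimes>\<^bsub>L\<^esub> x (Suc k)"]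
    by (simp add: L.a_comm)
  hence "sc u \<otimes>\<^bsub>L\<^esub> (sc (\<one> \<ominus> s \<otimes> r) \<otimes>\<^bsub>L\<^esub> x (Suc k)) = \<zero>\<^bsub>L\<^esub>" using u(1) by simp
  hence "x (Suc k) = \<zero>\<^bsub>L\<^esub>"
    using u s(1) rc x[of "Suc k"] by (simp add: L.m_assoc[symmetric] sc_sc sc_one)
  \<comment> \<open>Each term is a multiple of the next, so vanishing propagates back to index
    0.\<close>
  moreover have "x j = \<zero>\<^bsub>L\<^esub> \<Longrightarrow> x 0 = \<zero>\<^bsub>L\<^esub>" for j
  proof (induction j)
    case (Suc j)
    have "x j = \<zero>\<^bsub>L\<^esub>" unfolding div[of j] Suc.prems using rc by simp
    thus ?case by (rule Suc.IH)
  qed simp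
  ultimately show ?thesis by blast
qed

text \<open>A path longer than \<open>m + n\<close> lies in the \<open>m\<close>-th power of the
  arrow ideal. Modulo \<open>I\<close> it has coefficients in \<open>\<mm>\<close> by
  \<open>pow\<close>, and then by \<open>low\<close> it is a combination of paths of length 1 to
  \<open>n\<close>. One such rewriting suffices; \<open>m + n\<close> is a common bound for the
  paths that are kept and those that replace the others.\<close>

lemma finite_generation:
  assumes \<mm>: "\<mm> \<subseteq> carrier R"
    and pow: "ideal_power P (arrow_ideal R Q) m \<subseteq> I <+>\<^bsub>P\<^esub> coefficients_in R \<mm> Q"
    and low: "coefficients_in R \<mm> Q \<subseteq> I <+>\<^bsub>P\<^esub> family_sum P (paths_of_length R Q) {1..n}"
    and "f \<in> carrier P"
  shows "\<exists>g\<in>carrier P. {p. g p \<noteq> \<zero>} \<subseteq> {p \<in> paths Q. path_length p \<le> m + n} \<and> pr g = pr f"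
  using assms(4)
proof (induction rule: path_algebra_induct)
  case zero
  show ?case using P.zero_closed by (intro bexI[of _ "\<zero>\<^bsub>P\<^esub>"]) (auto simp: P_zero)
next
  case (add g h)
  then obtain g' h' where g': "g' \<in> carrier P" "{p. g' p \<noteq> \<zero>} \<subseteq> {p \<in> paths Q. path_length p \<le> m + n}" "pr g' = pr g"
    and h': "h' \<in> carrier P" "{p. h' p \<noteq> \<zero>} \<subseteq> {p \<in> paths Q. path_length p \<le> m + n}" "pr h' = pr h"
    by blast
  have "{p. (g' \<oplus>\<^bsub>P\<^esub> h') p \<noteq> \<zero>} \<subseteq> {p \<in> paths Q. path_length p \<le> m + n}"
    using support_add[OF g'(2) h'(2)] .
  moreover have "pr (g' \<oplus>\<^bsub>P\<^esub> h') = pr (g \<oplus>\<^bsub>P\<^esub> h)" using g' h' add(1,2) by simp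
  ultimately show ?case using g'(1) h'(1) by (intro bexI[of _ "g' \<oplus>\<^bsub>P\<^esub> h'"]) auto
next
  case (path p)
  have fp: "f p \<in> carrier R" using assms(4) by (simp add: P_carrier)
  have "\<exists>g\<in>carrier P. {q. g q \<noteq> \<zero>} \<subseteq> {q \<in> paths Q. path_length q \<le> m + n} \<and> pr g = pr (pe p)"
  proof (cases "path_length p \<le> m + n")
    case True
    thus ?thesis using path
      by (intro bexI[of _ "pe p"] conjI refl pe_closed) (auto simp: path_elem_def)
  next
    case False
    have "pe p \<in> I <+>\<^bsub>P\<^esub> coefficients_in R \<mm> Q"
      using long_path_in_ideal_power[OF path, of m] False pow by auto
    then obtain i h where h: "i \<in> I" "h \<in> coefficients_in R \<mm> Q" "pe p = i \<oplus>\<^bsub>P\<^esub> h"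
      by (auto simp: set_add_def')
    then obtain i' k where k: "i' \<in> I" "k \<in> family_sum P (paths_of_length R Q) {1..n}"
      "h = i' \<oplus>\<^bsub>P\<^esub> k" using low by (auto simp: set_add_def')
    then obtain x where x: "\<And>l. l \<in> {1..n} \<Longrightarrow> x l \<in> paths_of_length R Q l" "k = finsum P x {1..n}"
      unfolding family_sum_def by blast
    have xc: "x l \<in> carrier P" "x l q \<noteq> \<zero> \<Longrightarrow> q \<in> paths Q \<and> path_length q = l"
      if "l \<in> {1..n}" for l q
      using x(1)[OF that] by (auto simp: paths_of_length_def P_carrier)
    have "finsum P x A \<in> carrier P \<and>
        {q. finsum P x A q \<noteq> \<zero>} \<subseteq> {q \<in> paths Q. path_length q \<le> m + n}"
      if "finite A" "A \<subseteq> {1..n}" for A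
      using that
    proof (induction A rule: finite_induct)
      case empty
      show ?case using P.zero_closed by (simp add: P_zero)
    next
      case (insert l A)
      have "finsum P x (insert l A) = x l \<oplus>\<^bsub>P\<^esub> finsum P x A"
        using insert xc(1) by (intro P.finsum_insert) auto
      moreover have "{q. (x l \<oplus>\<^bsub>P\<^esub> finsum P x A) q \<noteq> \<zero>} \<subseteq> {q \<in> paths Q. path_length q \<le> m + n}"
      proof (rule support_add)
        show "{q. x l q \<noteq> \<zero>} \<subseteq> {q \<in> paths Q. path_length q \<le> m + n}"
          using insert(4) xc(2)[of l] by fastforce
      qed (use insert in auto)
      ultimately show ?case using insert xc(1) by auto
    qed
    from this[of "{1..n}"] have kc: "k \<in> carrier P"
      "{q. k q \<noteq> \<zero>} \<subseteq> {q \<in> paths Q. path_length q \<le> m + n}" by (simp_all add: x(2))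
    have "h \<in> carrier P" using h(2) by (simp add: coefficients_in_def)
    hence "pr (pe p) = pr k"
      using pr_add_ideal[OF h(1)] pr_add_ideal[OF k(1) kc(1)] h(3) k(3) by simp
    thus ?thesis using kc by (intro bexI[of _ k]) auto
  qed
  then obtain g where g: "g \<in> carrier P"
    "{q. g q \<noteq> \<zero>} \<subseteq> {q \<in> paths Q. path_length q \<le> m + n}" "pr g = pr (pe p)" by blast
  have "{q. smult (f p) g q \<noteq> \<zero>} \<subseteq> {q \<in> paths Q. path_length q \<le> m + n}"
    using support_smult[OF fp g(2)] .
  moreover have "pr (smult (f p) g) = pr (smult (f p) (pe p))"
    using sc_mult(1)[OF fp g(1)] sc_mult(1)[OF fp pe_closed[OF path]] g(3) by simp
  ultimately show ?case using smult_closed[OF fp g(1)] by (intro bexI[of _ "smult (f p) g"]) auto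
qed

lemma divisible_bounded_below:
  assumes "local_ring_with R \<mm>" "noetherian_ring R" "bounded_below R \<mm> Q I"
    and "\<And>i::nat. x i \<in> carrier L" "s \<in> sc ` \<mm>" "\<And>i. x i = s \<otimes>\<^bsub>L\<^esub> x (Suc i)"
  shows "x 0 = \<zero>\<^bsub>L\<^esub>"
proof -
  interpret m: ideal \<mm> R using assms(1) by (simp add: local_ring_with_def maximalideal_def)
  obtain m n where
    "ideal_power P (arrow_ideal R Q) m \<subseteq> I <+>\<^bsub>P\<^esub> coefficients_in R \<mm> Q"
    "coefficients_in R \<mm> Q \<subseteq> I <+>\<^bsub>P\<^esub> family_sum P (paths_of_length R Q) {1..n}"
    using assms(3) unfolding bounded_below_def by blast
  note gen = finite_generation[OF m.a_subset this]
  obtain r where r: "r \<in> \<mm>" "s = sc r" using assms(5) by blast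
  show ?thesis
  proof (rule infinitely_divisible_eq_zero[OF assms(1,2) finite_short_paths _ gen assms(4) r(1)])
    show "x i = sc r \<otimes>\<^bsub>L\<^esub> x (Suc i)" for i
      unfolding r(2)[symmetric] by (rule assms(6))
  qed auto
qed

text \<open>Supplies the constant of \<open>deep\<close>: it is the exponent \<open>m\<close> of
  \<open>bounded_below\<close>, since a path of length \<open>m\<close> lies in the
  \<open>m\<close>-th power of the arrow ideal.\<close>

lemma long_path_coefficients:
  assumes "bounded_below R \<mm> Q I"
  shows "\<exists>m. \<forall>p\<in>paths Q. path_length p = m \<longrightarrow> (\<exists>g\<in>coefficients_in R \<mm> Q. pr (pe p) = pr g)"
proof -
  obtain m where m: "ideal_power P (arrow_ideal R Q) m \<subseteq> I <+>\<^bsub>P\<^esub> coefficients_in R \<mm> Q"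
    using assms unfolding bounded_below_def by blast
  have "\<exists>g\<in>coefficients_in R \<mm> Q. pr (pe p) = pr g" if p: "p \<in> paths Q" "path_length p = m" for p
  proof -
    have "pe p \<in> I <+>\<^bsub>P\<^esub> coefficients_in R \<mm> Q"
      using long_path_in_ideal_power[OF p(1), of m] p(2) m by auto
    then obtain i g where g: "i \<in> I" "g \<in> coefficients_in R \<mm> Q" "pe p = i \<oplus>\<^bsub>P\<^esub> g"
      by (auto simp: set_add_def')
    hence "pr (pe p) = pr g" using pr_add_ideal[OF g(1), of g] by (simp add: coefficients_in_def)
    thus ?thesis using g(2) by blast
  qed
  thus ?thesis by blast
qed

text \<open>Term by term, the coefficient \<open>g p\<close> from \<open>\<mm>\<close> is central in
  the quotient and can be moved next to \<open>y\<close>. The set \<open>N\<close> enters only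
  through sums, so the two halves serve left and right submodules.\<close>

lemma coefficients_action:
  assumes \<mm>: "ideal \<mm> R" and g: "g \<in> coefficients_in R \<mm> Q"
    and N: "\<zero>\<^bsub>L\<^esub> \<in> N" "\<And>x y. x \<in> N \<Longrightarrow> y \<in> N \<Longrightarrow> x \<oplus>\<^bsub>L\<^esub> y \<in> N"
    and y: "y \<in> carrier L"
  shows "(\<And>s x. s \<in> sc ` \<mm> \<Longrightarrow> x \<in> carrier L \<Longrightarrow> x \<otimes>\<^bsub>L\<^esub> (s \<otimes>\<^bsub>L\<^esub> y) \<in> N) \<Longrightarrow> pr g \<otimes>\<^bsub>L\<^esub> y \<in> N"
    and "(\<And>s x. s \<in> sc ` \<mm> \<Longrightarrow> x \<in> carrier L \<Longrightarrow> (y \<otimes>\<^bsub>L\<^esub> s) \<otimes>\<^bsub>L\<^esub> x \<in> N) \<Longrightarrow> y \<otimes>\<^bsub>L\<^esub> pr g \<in> N"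
proof -
  interpret m: ideal \<mm> R by fact
  have gP: "g \<in> carrier P" using g by (simp add: coefficients_in_def)
  have gm: "g p \<in> \<mm>" if "p \<in> paths Q" for p using g that by (simp add: coefficients_in_def)
  have gc: "g p \<in> carrier R" for p using gP by (simp add: P_carrier)
  show "pr g \<otimes>\<^bsub>L\<^esub> y \<in> N"
    if *: "\<And>s x. s \<in> sc ` \<mm> \<Longrightarrow> x \<in> carrier L \<Longrightarrow> x \<otimes>\<^bsub>L\<^esub> (s \<otimes>\<^bsub>L\<^esub> y) \<in> N"
    using gP
  proof (induction rule: path_algebra_induct)
    case zero
    show ?case using N(1) y by simp
  next
    case (add g h)
    thus ?case using N(2) y by (simp add: L.l_distr)
  next
    case (path p)
    have "pr (smult (g p) (pe p)) \<otimes>\<^bsub>L\<^esub> y = pr (pe p) \<otimes>\<^bsub>L\<^esub> (sc (g p) \<otimes>\<^bsub>L\<^esub> y)"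
      using path gc y by (simp add: sc_mult(2)[symmetric] L.m_assoc)
    thus ?case using *[of "sc (g p)" "pr (pe p)"] gm[OF path] path by simp
  qed
  show "y \<otimes>\<^bsub>L\<^esub> pr g \<in> N"
    if *: "\<And>s x. s \<in> sc ` \<mm> \<Longrightarrow> x \<in> carrier L \<Longrightarrow> (y \<otimes>\<^bsub>L\<^esub> s) \<otimes>\<^bsub>L\<^esub> x \<in> N"
    using gP
  proof (induction rule: path_algebra_induct)
    case zero
    show ?case using N(1) y by simp
  next
    case (add g h)
    thus ?case using N(2) y by (simp add: L.r_distr)
  next
    case (path p)
    have "y \<otimes>\<^bsub>L\<^esub> pr (smult (g p) (pe p)) = (y \<otimes>\<^bsub>L\<^esub> sc (g p)) \<otimes>\<^bsub>L\<^esub> pr (pe p)"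
      using path gc y by (simp add: sc_mult(1)[symmetric] L.m_assoc)
    thus ?case using *[of "sc (g p)" "pr (pe p)"] gm[OF path] path by simp
  qed
qed

end

section \<open>Extending admissible paths\<close>

definition opposite_ring :: "('l, 'x) ring_scheme \<Rightarrow> ('l, 'x) ring_scheme" where
  "opposite_ring L = L\<lparr>monoid.mult := \<lambda>x y. y \<otimes>\<^bsub>L\<^esub> x\<rparr>"

lemma opposite_ring_simps [simp]:
  "carrier (opposite_ring L) = carrier L" "x \<otimes>\<^bsub>opposite_ring L\<^esub> y = y \<otimes>\<^bsub>L\<^esub> x"
  "\<one>\<^bsub>opposite_ring L\<^esub> = \<one>\<^bsub>L\<^esub>" "\<zero>\<^bsub>opposite_ring L\<^esub> = \<zero>\<^bsub>L\<^esub>"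
  "x \<oplus>\<^bsub>opposite_ring L\<^esub> y = x \<oplus>\<^bsub>L\<^esub> y"
  by (simp_all add: opposite_ring_def)

lemma ring_opposite_ring: "ring L \<Longrightarrow> ring (opposite_ring L)"
proof -
  assume "ring L"
  then interpret ring L .
  show ?thesis
  proof (rule ringI)
    show "abelian_group (opposite_ring L)"
      by (rule abelian_groupI) (auto simp: a_ac intro: add.l_inv_ex)
    show "monoid (opposite_ring L)"
      by (rule monoidI) (auto simp: m_assoc)
  qed (simp_all add: l_distr r_distr)
qed

text \<open>The additive structure is shared, hence so are additive subgroups and finite sums; only
  the side of the action changes. Equations between functions can be unfolded under any
  arguments.\<close>

lemma opposite_ring_modules:
  "left_submodule (opposite_ring L) = right_submodule L"
  "maximal_left_submodule (opposite_ring L) = maximal_right_submodule L"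
  "left_cyclic (opposite_ring L) = right_cyclic L"
  "left_local (opposite_ring L) = right_local L"
  "left_rad (opposite_ring L) = right_rad L"
  "family_sum (opposite_ring L) = family_sum L"
proof -
  have "add_monoid (opposite_ring L) = add_monoid L" by (simp add: opposite_ring_def)
  hence *: "additive_subgroup H (opposite_ring L) = additive_subgroup H L"
    "finsum (opposite_ring L) = finsum L" for H
    by (simp_all add: additive_subgroup_def finsum_def[abs_def])
  show sub: "left_submodule (opposite_ring L) = right_submodule L"
    by (intro ext) (simp add: left_submodule_def right_submodule_def *)
  show max: "maximal_left_submodule (opposite_ring L) = maximal_right_submodule L"
    by (intro ext) (simp add: maximal_left_submodule_def maximal_right_submodule_def sub)
  show "left_cyclic (opposite_ring L) = right_cyclic L"
    by (intro ext) (simp add: left_cyclic_def right_cyclic_def)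
  show "left_local (opposite_ring L) = right_local L"
    by (intro ext) (simp add: left_local_def right_local_def max)
  show "left_rad (opposite_ring L) = right_rad L"
    by (intro ext) (simp add: left_rad_def right_rad_def max)
  show "family_sum (opposite_ring L) = family_sum L"
    by (intro ext) (simp add: family_sum_def *)
qed

section \<open>One-arrow extensions of admissible paths\<close>

context quiver_quotient
begin

abbreviation el where "el \<equiv> path_coset R Q I"

lemma el_closed: "p \<in> paths Q \<Longrightarrow> el p \<in> carrier L"
  by (simp add: path_coset_def)

lemma el_comp: "p \<in> paths Q \<Longrightarrow> q \<in> paths Q \<Longrightarrow> path_tail p = path_head q \<Longrightarrow>
    el (path_comp p q) = el p \<otimes>\<^bsub>L\<^esub> el q"
  by (simp add: path_coset_def pe_comp)

lemma admissible_iff: "admissible R Q I p \<longleftrightarrow> p \<in> paths Q \<and> el p \<noteq> \<zero>\<^bsub>L\<^esub>"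
  using pr_eq_zero[of "pe p"] by (auto simp: admissible_def path_coset_def)

lemma arrow_path_ends [simp]:
  "path_tail (arrow_path Q c) = tail Q c" "path_head (arrow_path Q c) = head Q c"
  by (simp_all add: arrow_path_def)

lemma path_length_arrow_path [simp]: "path_length (arrow_path Q c) = 1"
  by (simp add: path_length_def arrow_path_def)

lemma path_length_trivial [simp]: "path_length (trivial_path v) = 0"
  by (simp add: path_length_def trivial_path_def)

lemma path_length_comp [simp]: "path_length (path_comp p q) = path_length p + path_length q"
  by (simp add: path_length_def path_comp_def)

lemma admissible_comp:
  assumes "admissible R Q I (path_comp p q)" "p \<in> paths Q" "q \<in> paths Q" "path_tail p = path_head q"
  shows "admissible R Q I p" "admissible R Q I q"
proof -
  have "el p \<otimes>\<^bsub>L\<^esub> el q \<noteq> \<zero>\<^bsub>L\<^esub>"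
    using assms(1) el_comp[OF assms(2-4)] by (simp add: admissible_iff)
  hence "el p \<noteq> \<zero>\<^bsub>L\<^esub>" "el q \<noteq> \<zero>\<^bsub>L\<^esub>"
    using el_closed assms(2,3) L.l_null L.r_null by metis+
  thus "admissible R Q I p" "admissible R Q I q" using assms(2,3) by (simp_all add: admissible_iff)
qed

text \<open>Trivial paths are left out because \<open>special\<close> limits extensions only next to
  a given arrow; several arrows may start or end at one vertex.\<close>

definition admissibles :: "('c, 'd) path set" where
  "admissibles = {q. admissible R Q I q \<and> path_length q \<ge> 1}"

definition left_step :: "('c, 'd) path \<Rightarrow> ('c, 'd) path \<Rightarrow> bool" where
  "left_step q q' \<longleftrightarrow> (\<exists>c\<in>arcs Q. tail Q c = path_head q \<and>
     q' = path_comp (arrow_path Q c) q \<and> admissible R Q I q')"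

definition right_step :: "('c, 'd) path \<Rightarrow> ('c, 'd) path \<Rightarrow> bool" where
  "right_step q q' \<longleftrightarrow> (\<exists>c\<in>arcs Q. head Q c = path_tail q \<and>
     q' = path_comp q (arrow_path Q c) \<and> admissible R Q I q')"

text \<open>Beyond exhibiting \<open>p\<close> as a right subpath, the exact length of
  \<open>w\<close> is what connects \<open>n\<close> steps with
  \<open>long_path_coefficients\<close>.\<close>

lemma left_steps:
  assumes "(left_step ^^ n) p q" "p \<in> paths Q"
  shows "\<exists>w\<in>paths Q. path_length w = n \<and> path_tail w = path_head p \<and> q = path_comp w p"
  using assms(1)
proof (induction n arbitrary: q)
  case 0
  thus ?case
    using trivial_path_in_paths[OF quiver ends_closed(2)[OF assms(2)]]
    by (intro bexI[of _ "trivial_path (path_head p)"]) simp_all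
next
  case (Suc n)
  then obtain q' where q': "(left_step ^^ n) p q'" "left_step q' q" by auto
  obtain w where w: "w \<in> paths Q" "path_length w = n" "path_tail w = path_head p"
    "q' = path_comp w p" using Suc.IH[OF q'(1)] by blast
  obtain c where c: "c \<in> arcs Q" "tail Q c = path_head w" "q = path_comp (arrow_path Q c) q'"
    using q'(2) w(4) by (auto simp: left_step_def)
  show ?case
    using w c comp_closed[OF arrow_path_in[OF c(1)] w(1)]
    by (intro bexI[of _ "path_comp (arrow_path Q c) w"]) (simp_all add: path_comp_assoc)
qed

lemma right_steps:
  assumes "(right_step ^^ n) p q" "p \<in> paths Q"
  shows "\<exists>w\<in>paths Q. path_length w = n \<and> path_head w = path_tail p \<and> q = path_comp p w"
  using assms(1)
proof (induction n arbitrary: q)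
  case 0
  thus ?case
    using trivial_path_in_paths[OF quiver ends_closed(1)[OF assms(2)]]
    by (intro bexI[of _ "trivial_path (path_tail p)"]) simp_all
next
  case (Suc n)
  then obtain q' where q': "(right_step ^^ n) p q'" "right_step q' q" by auto
  obtain w where w: "w \<in> paths Q" "path_length w = n" "path_head w = path_tail p"
    "q' = path_comp p w" using Suc.IH[OF q'(1)] by blast
  obtain c where c: "c \<in> arcs Q" "head Q c = path_tail w" "q = path_comp q' (arrow_path Q c)"
    using q'(2) w(4) by (auto simp: right_step_def)
  show ?case
    using w c comp_closed[OF w(1) arrow_path_in[OF c(1)]]
    by (intro bexI[of _ "path_comp w (arrow_path Q c)"]) (simp_all add: path_comp_assoc)
qed

lemma left_steps_subpath:
  assumes "left_step\<^sup>*\<^sup>* p q" "p \<in> paths Q"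
  shows "right_subpath Q p q"
proof -
  obtain n where "(left_step ^^ n) p q" using assms(1) by (auto simp: rtranclp_power)
  thus ?thesis using left_steps[OF _ assms(2)] by (auto simp: right_subpath_def)
qed

lemma right_steps_subpath:
  assumes "right_step\<^sup>*\<^sup>* p q" "p \<in> paths Q"
  shows "left_subpath Q p q"
proof -
  obtain n where "(right_step ^^ n) p q" using assms(1) by (auto simp: rtranclp_power)
  then obtain w where "w \<in> paths Q" "path_head w = path_tail p" "q = path_comp p w"
    using right_steps[OF _ assms(2)] by blast
  thus ?thesis unfolding left_subpath_def by metis
qed

text \<open>Removing left arrows one by one preserves the right arrow and, since factors of
  admissible paths are admissible, also admissibility, until a single arrow remains.\<close>

lemma reach_from_right_arrow:
  assumes "admissible R Q I p" "path_length p = Suc n"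
  shows "arrow_path Q (right_arrow p) \<in> admissibles"
    and "left_step\<^sup>*\<^sup>* (arrow_path Q (right_arrow p)) p"
proof -
  have "arrow_path Q (right_arrow p) \<in> admissibles \<and> left_step\<^sup>*\<^sup>* (arrow_path Q (right_arrow p)) p"
    using assms
  proof (induction n arbitrary: p)
    case 0
    have p: "p \<in> paths Q" "path_length p \<ge> 1" using 0 by (auto simp: admissible_iff)
    obtain p' c where *: "c \<in> arcs Q" "p' \<in> paths Q" "path_tail p' = head Q c"
      "p = path_comp p' (arrow_path Q c)" "path_length p = Suc (path_length p')" "right_arrow p = c"
      using path_first_arrow[OF p] .
    have "p' = trivial_path (head Q c)" using trivial_path_unique(1)[OF *(2)] *(3,5) 0 by simp
    hence "p = arrow_path Q c" using *(4) path_comp_trivial(1)[of "arrow_path Q c"] by simp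
    thus ?case using *(6) 0 by (simp add: admissibles_def)
  next
    case (Suc n)
    have p: "p \<in> paths Q" "path_length p \<ge> 1" using Suc.prems by (auto simp: admissible_iff)
    obtain p' c where *: "c \<in> arcs Q" "p' \<in> paths Q" "path_head p' = tail Q c"
      "p = path_comp (arrow_path Q c) p'" "path_length p = Suc (path_length p')"
      using path_last_arrow[OF p] .
    have adm: "admissible R Q I p'"
      using admissible_comp(2)[of "arrow_path Q c" p'] Suc.prems(1) * arrow_path_in[OF *(1)] by simp
    have "path_arrows p' \<noteq> []" using *(5) Suc.prems by (auto simp: path_length_def)
    hence ra: "right_arrow p = right_arrow p'"
      unfolding *(4) by (simp add: right_arrow_def path_comp_def)
    have "left_step p' p" using * Suc.prems(1) by (auto simp: left_step_def)
    thus ?case using Suc.IH[OF adm] *(5) Suc.prems(2) ra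
      by (auto intro: rtranclp.rtrancl_into_rtrancl)
  qed
  thus "arrow_path Q (right_arrow p) \<in> admissibles"
    "left_step\<^sup>*\<^sup>* (arrow_path Q (right_arrow p)) p" by blast+
qed

lemma reach_from_left_arrow:
  assumes "admissible R Q I p" "path_length p = Suc n"
  shows "arrow_path Q (left_arrow p) \<in> admissibles"
    and "right_step\<^sup>*\<^sup>* (arrow_path Q (left_arrow p)) p"
proof -
  have "arrow_path Q (left_arrow p) \<in> admissibles \<and> right_step\<^sup>*\<^sup>* (arrow_path Q (left_arrow p)) p"
    using assms
  proof (induction n arbitrary: p)
    case 0
    have p: "p \<in> paths Q" "path_length p \<ge> 1" using 0 by (auto simp: admissible_iff)
    obtain p' c where *: "c \<in> arcs Q" "p' \<in> paths Q" "path_head p' = tail Q c"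
      "p = path_comp (arrow_path Q c) p'" "path_length p = Suc (path_length p')" "left_arrow p = c"
      using path_last_arrow[OF p] .
    have "p' = trivial_path (tail Q c)" using trivial_path_unique[OF *(2)] *(3,5) 0 by simp
    hence "p = arrow_path Q c" using *(4) path_comp_trivial(2)[of "arrow_path Q c"] by simp
    thus ?case using *(6) 0 by (simp add: admissibles_def)
  next
    case (Suc n)
    have p: "p \<in> paths Q" "path_length p \<ge> 1" using Suc.prems by (auto simp: admissible_iff)
    obtain p' c where *: "c \<in> arcs Q" "p' \<in> paths Q" "path_tail p' = head Q c"
      "p = path_comp p' (arrow_path Q c)" "path_length p = Suc (path_length p')"
      using path_first_arrow[OF p] .
    have adm: "admissible R Q I p'"
      using admissible_comp(1)[of p' "arrow_path Q c"] Suc.prems(1) * arrow_path_in[OF *(1)] by simp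
    have "path_arrows p' \<noteq> []" using *(5) Suc.prems by (auto simp: path_length_def)
    hence la: "left_arrow p = left_arrow p'"
      unfolding *(4) by (simp add: left_arrow_def path_comp_def)
    have "right_step p' p" using * Suc.prems(1) by (auto simp: right_step_def)
    thus ?case using Suc.IH[OF adm] *(5) Suc.prems(2) la
      by (auto intro: rtranclp.rtrancl_into_rtrancl)
  qed
  thus "arrow_path Q (left_arrow p) \<in> admissibles"
    "right_step\<^sup>*\<^sup>* (arrow_path Q (left_arrow p)) p" by blast+
qed

text \<open>Write \<open>q = b q'\<close> with left arrow \<open>b\<close>. If \<open>d b\<close>
  were in \<open>I\<close>, then \<open>d q = d b q'\<close> would vanish in the quotient. So
  \<open>c\<close> and \<open>c'\<close> both have admissible products with the same arrow
  \<open>b\<close>, to which \<open>special\<close> applies.\<close>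

lemma left_step_unique:
  assumes special: "special R Q I" and q: "q \<in> admissibles"
    and c: "c \<in> arcs Q" "tail Q c = path_head q" "el (arrow_path Q c) \<otimes>\<^bsub>L\<^esub> el q \<noteq> \<zero>\<^bsub>L\<^esub>"
    and c': "c' \<in> arcs Q" "tail Q c' = path_head q" "el (arrow_path Q c') \<otimes>\<^bsub>L\<^esub> el q \<noteq> \<zero>\<^bsub>L\<^esub>"
  shows "c = c'"
proof -
  have qp: "q \<in> paths Q" "path_length q \<ge> 1" using q by (auto simp: admissibles_def admissible_iff)
  obtain q' b where *: "b \<in> arcs Q" "q' \<in> paths Q" "path_head q' = tail Q b"
    "q = path_comp (arrow_path Q b) q'" using path_last_arrow[OF qp] .
  have ne: "pe (arrow_path Q d) \<otimes>\<^bsub>P\<^esub> pe (arrow_path Q b) \<notin> I"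
    if d: "d \<in> arcs Q" "el (arrow_path Q d) \<otimes>\<^bsub>L\<^esub> el q \<noteq> \<zero>\<^bsub>L\<^esub>" for d
  proof
    assume "pe (arrow_path Q d) \<otimes>\<^bsub>P\<^esub> pe (arrow_path Q b) \<in> I"
    hence "pr (pe (arrow_path Q d) \<otimes>\<^bsub>P\<^esub> pe (arrow_path Q b)) = \<zero>\<^bsub>L\<^esub>"
      using pr_eq_zero I.Icarr by blast
    hence "el (arrow_path Q d) \<otimes>\<^bsub>L\<^esub> el (arrow_path Q b) = \<zero>\<^bsub>L\<^esub>"
      using arrow_path_in d(1) *(1) by (simp add: path_coset_def)
    hence "el (arrow_path Q d) \<otimes>\<^bsub>L\<^esub> el q = \<zero>\<^bsub>L\<^esub>"
      using * arrow_path_in d(1) by (simp add: el_comp el_closed L.m_assoc[symmetric])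
    thus False using d(2) by blast
  qed
  have "tail Q c = head Q b" "tail Q c' = head Q b" using c(2) c'(2) *(4) by simp_all
  thus ?thesis
    using special *(1) c(1) c'(1) ne[OF c(1,3)] ne[OF c'(1,3)] unfolding special_def Let_def by blast
qed

lemma right_step_unique:
  assumes special: "special R Q I" and q: "q \<in> admissibles"
    and c: "c \<in> arcs Q" "head Q c = path_tail q" "el q \<otimes>\<^bsub>L\<^esub> el (arrow_path Q c) \<noteq> \<zero>\<^bsub>L\<^esub>"
    and c': "c' \<in> arcs Q" "head Q c' = path_tail q" "el q \<otimes>\<^bsub>L\<^esub> el (arrow_path Q c') \<noteq> \<zero>\<^bsub>L\<^esub>"
  shows "c = c'"
proof -
  have qp: "q \<in> paths Q" "path_length q \<ge> 1" using q by (auto simp: admissibles_def admissible_iff)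
  obtain q' b where *: "b \<in> arcs Q" "q' \<in> paths Q" "path_tail q' = head Q b"
    "q = path_comp q' (arrow_path Q b)" using path_first_arrow[OF qp] .
  have ne: "pe (arrow_path Q b) \<otimes>\<^bsub>P\<^esub> pe (arrow_path Q d) \<notin> I"
    if d: "d \<in> arcs Q" "el q \<otimes>\<^bsub>L\<^esub> el (arrow_path Q d) \<noteq> \<zero>\<^bsub>L\<^esub>" for d
  proof
    assume "pe (arrow_path Q b) \<otimes>\<^bsub>P\<^esub> pe (arrow_path Q d) \<in> I"
    hence "pr (pe (arrow_path Q b) \<otimes>\<^bsub>P\<^esub> pe (arrow_path Q d)) = \<zero>\<^bsub>L\<^esub>"
      using pr_eq_zero I.Icarr by blast
    hence "el (arrow_path Q b) \<otimes>\<^bsub>L\<^esub> el (arrow_path Q d) = \<zero>\<^bsub>L\<^esub>"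
      using arrow_path_in d(1) *(1) by (simp add: path_coset_def)
    hence "el q \<otimes>\<^bsub>L\<^esub> el (arrow_path Q d) = \<zero>\<^bsub>L\<^esub>"
      using * arrow_path_in d(1) by (simp add: el_comp el_closed L.m_assoc)
    thus False using d(2) by blast
  qed
  have "head Q c = tail Q b" "head Q c' = tail Q b" using c(2) c'(2) *(4) by simp_all
  thus ?thesis
    using special *(1) c(1) c'(1) ne[OF c(1,3)] ne[OF c'(1,3)] unfolding special_def Let_def by blast
qed

end

section \<open>The two chain structures and the conclusion\<close>

locale string_quotient = quiver_quotient R Q I
  for R :: "('r, 'x) ring_scheme" (structure) and Q :: "('v, 'e) pre_digraph" and I +
  fixes \<mm>
  assumes local: "local_ring_with R \<mm>" and noeth: "noetherian_ring R"
    and arrow_radical: "arrow_radical R Q I" and bounded_below: "bounded_below R \<mm> Q I"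
    and special: "special R Q I"
begin

lemma \<mm>_ideal: "ideal \<mm> R"
  using local by (simp add: local_ring_with_def maximalideal_def)

text \<open>The conditions on right modules are phrased over \<open>opposite_ring L\<close>, so that
  the results on left modules accept them unchanged.\<close>

lemma radicals:
  assumes "v \<in> verts Q"
  shows "left_local L (left_cyclic L (el (trivial_path v)))"
    and "left_rad L (left_cyclic L (el (trivial_path v))) =
      family_sum L (\<lambda>c. left_cyclic L (el (arrow_path Q c))) {c \<in> arcs Q. tail Q c = v}"
    and "left_local (opposite_ring L) (left_cyclic (opposite_ring L) (el (trivial_path v)))"
    and "left_rad (opposite_ring L) (left_cyclic (opposite_ring L) (el (trivial_path v))) =
      family_sum (opposite_ring L) (\<lambda>c. left_cyclic (opposite_ring L) (el (arrow_path Q c)))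
        {c \<in> arcs Q. head Q c = v}"
  using arrow_radical assms
  unfolding arrow_radical_def Let_def opposite_ring_modules
  by (simp_all add: left_path_module_def[abs_def] right_path_module_def[abs_def])

lemma finite_arcs: "finite {c \<in> arcs Q. T c}"
  using fin_digraph.finite_arcs[OF quiver] by simp

lemma el_ends:
  assumes "p \<in> paths Q"
  shows "el (trivial_path (path_head p)) \<otimes>\<^bsub>L\<^esub> el p = el p"
    and "el p \<otimes>\<^bsub>L\<^esub> el (trivial_path (path_tail p)) = el p"
  using el_comp[of "trivial_path (path_head p)" p] el_comp[of p "trivial_path (path_tail p)"]
    trivial_path_in_paths[OF quiver] ends_closed[OF assms] assms by simp_all

lemma \<mm>_scalars: "s \<in> sc ` \<mm> \<Longrightarrow> s \<in> carrier L"
  using sc_closed ideal.Icarr[OF \<mm>_ideal] by blast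

lemma \<mm>_scalars_central: "s \<in> sc ` \<mm> \<Longrightarrow> x \<in> carrier L \<Longrightarrow> s \<otimes>\<^bsub>L\<^esub> x = x \<otimes>\<^bsub>L\<^esub> s"
  using sc_central ideal.Icarr[OF \<mm>_ideal] by blast

lemma admissibles_paths: "q \<in> admissibles \<Longrightarrow> q \<in> paths Q \<and> el q \<noteq> \<zero>\<^bsub>L\<^esub>"
  by (simp add: admissibles_def admissible_iff)

lemma left_stepE:
  assumes "q \<in> admissibles" "left_step q q'"
  obtains c where "c \<in> arcs Q" "tail Q c = path_head q" "q' = path_comp (arrow_path Q c) q"
    "el q' = el (arrow_path Q c) \<otimes>\<^bsub>L\<^esub> el q" "el q' \<noteq> \<zero>\<^bsub>L\<^esub>" "q' \<in> admissibles"
proof -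
  obtain c where c: "c \<in> arcs Q" "tail Q c = path_head q" "q' = path_comp (arrow_path Q c) q" "admissible R Q I q'"
    using assms(2) by (auto simp: left_step_def)
  show ?thesis
  proof (rule that[OF c(1-3)])
    show "el q' = el (arrow_path Q c) \<otimes>\<^bsub>L\<^esub> el q"
      unfolding c(3) using c(1,2) admissibles_paths[OF assms(1)] arrow_path_in
      by (intro el_comp) simp_all
    show "el q' \<noteq> \<zero>\<^bsub>L\<^esub>" using c(4) by (simp add: admissible_iff)
    show "q' \<in> admissibles" using c(3,4) by (simp add: admissibles_def)
  qed
qed

lemma right_stepE:
  assumes "q \<in> admissibles" "right_step q q'"
  obtains c where "c \<in> arcs Q" "head Q c = path_tail q" "q' = path_comp q (arrow_path Q c)"
    "el q' = el q \<otimes>\<^bsub>L\<^esub> el (arrow_path Q c)" "el q' \<noteq> \<zero>\<^bsub>L\<^esub>" "q' \<in> admissibles"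
proof -
  obtain c where c: "c \<in> arcs Q" "head Q c = path_tail q" "q' = path_comp q (arrow_path Q c)" "admissible R Q I q'"
    using assms(2) by (auto simp: right_step_def)
  show ?thesis
  proof (rule that[OF c(1-3)])
    show "el q' = el q \<otimes>\<^bsub>L\<^esub> el (arrow_path Q c)"
      unfolding c(3) using c(1,2) admissibles_paths[OF assms(1)] arrow_path_in
      by (intro el_comp) simp_all
    show "el q' \<noteq> \<zero>\<^bsub>L\<^esub>" using c(4) by (simp add: admissible_iff)
    show "q' \<in> admissibles" using c(3,4) by (simp add: admissibles_def)
  qed
qed

text \<open>In the results on local modules, \<open>e\<close> is the class of the trivial path at
  the head of \<open>p\<close>, \<open>y\<close> that of \<open>p\<close>, and the
  \<open>x c\<close> are those of the arrows leaving this head.\<close>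

sublocale left: uniserial_chain L admissibles left_step el "sc ` \<mm>"
proof
  fix p q q' N and z :: "nat \<Rightarrow> (('v, 'e) path \<Rightarrow> 'r) set" and s x
  show "s \<in> sc ` \<mm> \<Longrightarrow> x \<in> carrier L \<Longrightarrow> s \<otimes>\<^bsub>L\<^esub> x = x \<otimes>\<^bsub>L\<^esub> s" by (rule \<mm>_scalars_central)
  show "sc ` \<mm> \<subseteq> carrier L" using \<mm>_scalars by blast
  show "z 0 = \<zero>\<^bsub>L\<^esub>" if "\<And>i. z i \<in> carrier L" "s \<in> sc ` \<mm>" "\<And>i. z i = s \<otimes>\<^bsub>L\<^esub> z (Suc i)"
    by (rule divisible_bounded_below[where x = z, OF local noeth bounded_below that])
  assume p: "p \<in> admissibles"
  have pp: "p \<in> paths Q" "el p \<noteq> \<zero>\<^bsub>L\<^esub>" "el p \<in> carrier L"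
    using admissibles_paths[OF p] el_closed by auto
  show "el p \<in> carrier L" by (rule pp)
  let ?e = "trivial_path (path_head p) :: ('v, 'e) path"
  have v: "path_head p \<in> verts Q" using ends_closed pp by blast
  have e: "?e \<in> paths Q" by (rule trivial_path_in_paths[OF quiver v])
  note local_image = el_closed[OF e] radicals(1,2)[OF v]
  have arr: "el (arrow_path Q c) \<in> carrier L" if "c \<in> {c \<in> arcs Q. tail Q c = path_head p}" for c
    using that el_closed arrow_path_in by simp
  show "q = q'" if steps: "left_step p q" "left_step p q'"
  proof -
    obtain c where c: "c \<in> arcs Q" "tail Q c = path_head p" "q = path_comp (arrow_path Q c) p"
      "el q = el (arrow_path Q c) \<otimes>\<^bsub>L\<^esub> el p" "el q \<noteq> \<zero>\<^bsub>L\<^esub>"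
      using left_stepE[OF p steps(1)] .
    obtain c' where c': "c' \<in> arcs Q" "tail Q c' = path_head p" "q' = path_comp (arrow_path Q c') p"
      "el q' = el (arrow_path Q c') \<otimes>\<^bsub>L\<^esub> el p" "el q' \<noteq> \<zero>\<^bsub>L\<^esub>"
      using left_stepE[OF p steps(2)] .
    have "c = c'"
      by (rule left_step_unique[OF special p c(1,2) _ c'(1,2)]) (use c(4,5) c'(4,5) in simp_all)
    thus ?thesis using c(3) c'(3) by simp
  qed
  show "\<exists>q. left_step p q \<and> N \<subseteq> left_cyclic L (el q)"
    if N: "left_submodule L (left_cyclic L (el p)) N" "N \<noteq> left_cyclic L (el p)" "N \<noteq> {\<zero>\<^bsub>L\<^esub>}"
  proof -
    have "\<exists>c\<in>{c \<in> arcs Q. tail Q c = path_head p}. el (arrow_path Q c) \<otimes>\<^bsub>L\<^esub> el p \<noteq> \<zero>\<^bsub>L\<^esub> \<and>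
        N \<subseteq> left_cyclic L (el (arrow_path Q c) \<otimes>\<^bsub>L\<^esub> el p)"
      by (rule L.proper_submodule_of_local_image[OF local_image arr pp(3) el_ends(1)[OF pp(1)] N])
        (use left_step_unique[OF special p] in auto)
    then obtain c where c: "c \<in> arcs Q" "tail Q c = path_head p"
      "el (arrow_path Q c) \<otimes>\<^bsub>L\<^esub> el p \<noteq> \<zero>\<^bsub>L\<^esub>" "N \<subseteq> left_cyclic L (el (arrow_path Q c) \<otimes>\<^bsub>L\<^esub> el p)"
      by blast
    moreover have "el (path_comp (arrow_path Q c) p) = el (arrow_path Q c) \<otimes>\<^bsub>L\<^esub> el p"
      using c(1,2) arrow_path_in pp(1) by (simp add: el_comp)
    moreover have "path_comp (arrow_path Q c) p \<in> paths Q"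
      using c(1,2) arrow_path_in pp(1) by (simp add: comp_closed)
    ultimately show ?thesis
      by (intro exI[of _ "path_comp (arrow_path Q c) p"]) (auto simp: left_step_def admissible_iff)
  qed
  show "\<exists>M. \<forall>q N. (left_step ^^ M) p q \<longrightarrow> left_submodule L (carrier L) N \<longrightarrow>
      (\<forall>s\<in>sc ` \<mm>. s \<otimes>\<^bsub>L\<^esub> el p \<in> N) \<longrightarrow> el q \<in> N"
  proof -
    obtain M where M: "\<And>w. w \<in> paths Q \<Longrightarrow> path_length w = M \<Longrightarrow>
        \<exists>g\<in>coefficients_in R \<mm> Q. pr (pe w) = pr g"
      using long_path_coefficients[OF bounded_below] by blast
    have "el q \<in> N"
      if q: "(left_step ^^ M) p q" and N: "left_submodule L (carrier L) N"
        "\<forall>s\<in>sc ` \<mm>. s \<otimes>\<^bsub>L\<^esub> el p \<in> N" for q N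
    proof -
      obtain w where w: "w \<in> paths Q" "path_length w = M" "path_tail w = path_head p"
        "q = path_comp w p" using left_steps[OF q pp(1)] by blast
      obtain g where g: "g \<in> coefficients_in R \<mm> Q" "pr (pe w) = pr g" using M[OF w(1,2)] by blast
      note D = L.left_submoduleD[OF N(1)]
      \<comment> \<open>In the quotient \<open>w\<close> equals \<open>g\<close>, so
        \<open>el q\<close> is this product; its terms are multiples of elements
        \<open>s \<otimes> el p\<close> with \<open>s\<close> from \<open>\<mm>\<close>.\<close>
      have "pr g \<otimes>\<^bsub>L\<^esub> el p \<in> N"
        by (rule coefficients_action(1)[OF \<mm>_ideal g(1) D(3,4) pp(3)]) (use D(5) N(2) in auto)
      thus ?thesis using w pp(1) g(2) by (simp add: el_comp) (simp add: path_coset_def)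
    qed
    thus ?thesis by blast
  qed
  assume q: "left_step p q"
  obtain c where c: "c \<in> arcs Q" "tail Q c = path_head p" "q = path_comp (arrow_path Q c) p"
    "el q = el (arrow_path Q c) \<otimes>\<^bsub>L\<^esub> el p" "el q \<noteq> \<zero>\<^bsub>L\<^esub>" "q \<in> admissibles"
    using left_stepE[OF p q] .
  show "q \<in> admissibles" by (rule c)
  show "el q \<in> left_cyclic L (el p)"
    unfolding c(4) using el_closed arrow_path_in[OF c(1)] by (intro L.left_cyclicI) simp
  show "el p \<notin> left_cyclic L (el q)"
    unfolding c(4)
    by (rule L.left_cyclic_strict_in_local_image[OF local_image arr finite_arcs _ _ pp(3) _ pp(2)])
      (use c el_ends(1)[OF pp(1)] el_ends(2)[OF arrow_path_in[OF c(1)]] in simp_all)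
qed

text \<open>Left multiplication in the opposite ring attaches an arrow on the right of
  \<open>p\<close>, so \<open>e\<close> is now the trivial path at the tail of
  \<open>p\<close>.\<close>

sublocale right: uniserial_chain "opposite_ring L" admissibles right_step el "sc ` \<mm>"
proof -
  interpret op: ring "opposite_ring L" by (rule ring_opposite_ring[OF L.ring_axioms])
  show "uniserial_chain (opposite_ring L) admissibles right_step el (sc ` \<mm>)"
  proof
    fix p q q' N and z :: "nat \<Rightarrow> (('v, 'e) path \<Rightarrow> 'r) set" and s x
    show "x \<in> carrier (opposite_ring L) \<Longrightarrow>
        s \<otimes>\<^bsub>opposite_ring L\<^esub> x = x \<otimes>\<^bsub>opposite_ring L\<^esub> s" if "s \<in> sc ` \<mm>"
      using \<mm>_scalars_central[OF that] by simp
    show "sc ` \<mm> \<subseteq> carrier (opposite_ring L)" using \<mm>_scalars by auto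
    show "z 0 = \<zero>\<^bsub>opposite_ring L\<^esub>"
      if z: "\<And>i. z i \<in> carrier (opposite_ring L)" "s \<in> sc ` \<mm>"
        "\<And>i. z i = s \<otimes>\<^bsub>opposite_ring L\<^esub> z (Suc i)"
    proof -
      have zc: "z i \<in> carrier L" for i using z(1)[of i] by simp
      \<comment> \<open>Scalars are central, so divisibility over the opposite ring is divisibility
        over \<open>L\<close>.\<close>
      have zL: "z i = s \<otimes>\<^bsub>L\<^esub> z (Suc i)" for i
        using z(3)[of i] \<mm>_scalars_central[OF z(2) zc[of "Suc i"]] by (metis opposite_ring_simps(2))
      show ?thesis
        unfolding opposite_ring_simps
        by (rule divisible_bounded_below[where x = z, OF local noeth bounded_below zc z(2) zL])
    qed
    assume p: "p \<in> admissibles"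
    have pp: "p \<in> paths Q" "el p \<noteq> \<zero>\<^bsub>L\<^esub>" "el p \<in> carrier L"
      using admissibles_paths[OF p] el_closed by auto
    have pp': "el p \<noteq> \<zero>\<^bsub>opposite_ring L\<^esub>" "el p \<in> carrier (opposite_ring L)" using pp by simp_all
    show "el p \<in> carrier (opposite_ring L)" by (rule pp')
    let ?e = "trivial_path (path_tail p) :: ('v, 'e) path"
    have v: "path_tail p \<in> verts Q" using ends_closed pp by blast
    have e: "?e \<in> paths Q" by (rule trivial_path_in_paths[OF quiver v])
    have ec: "el ?e \<in> carrier (opposite_ring L)" using el_closed[OF e] by simp
    have ends: "el ?e \<otimes>\<^bsub>opposite_ring L\<^esub> el p = el p" using el_ends(2)[OF pp(1)] by simp
    note local_image = ec radicals(3,4)[OF v]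
    have arr: "el (arrow_path Q c) \<in> carrier (opposite_ring L)"
      if "c \<in> {c \<in> arcs Q. head Q c = path_tail p}" for c
      using that el_closed arrow_path_in by simp
    show "q = q'" if steps: "right_step p q" "right_step p q'"
    proof -
      obtain c where c: "c \<in> arcs Q" "head Q c = path_tail p" "q = path_comp p (arrow_path Q c)"
        "el q = el p \<otimes>\<^bsub>L\<^esub> el (arrow_path Q c)" "el q \<noteq> \<zero>\<^bsub>L\<^esub>"
        using right_stepE[OF p steps(1)] .
      obtain c' where c': "c' \<in> arcs Q" "head Q c' = path_tail p" "q' = path_comp p (arrow_path Q c')"
        "el q' = el p \<otimes>\<^bsub>L\<^esub> el (arrow_path Q c')" "el q' \<noteq> \<zero>\<^bsub>L\<^esub>"
        using right_stepE[OF p steps(2)] .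
      have "c = c'"
        by (rule right_step_unique[OF special p c(1,2) _ c'(1,2)]) (use c(4,5) c'(4,5) in simp_all)
      thus ?thesis using c(3) c'(3) by simp
    qed
    show "\<exists>q. right_step p q \<and> N \<subseteq> left_cyclic (opposite_ring L) (el q)"
      if N: "left_submodule (opposite_ring L) (left_cyclic (opposite_ring L) (el p)) N"
        "N \<noteq> left_cyclic (opposite_ring L) (el p)" "N \<noteq> {\<zero>\<^bsub>opposite_ring L\<^esub>}"
    proof -
      have "\<exists>c\<in>{c \<in> arcs Q. head Q c = path_tail p}.
          el (arrow_path Q c) \<otimes>\<^bsub>opposite_ring L\<^esub> el p \<noteq> \<zero>\<^bsub>opposite_ring L\<^esub> \<and>
          N \<subseteq> left_cyclic (opposite_ring L) (el (arrow_path Q c) \<otimes>\<^bsub>opposite_ring L\<^esub> el p)"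
        by (rule op.proper_submodule_of_local_image[OF local_image arr pp'(2) ends N])
          (use right_step_unique[OF special p] in auto)
      then obtain c where c: "c \<in> arcs Q" "head Q c = path_tail p"
        "el p \<otimes>\<^bsub>L\<^esub> el (arrow_path Q c) \<noteq> \<zero>\<^bsub>L\<^esub>"
        "N \<subseteq> left_cyclic (opposite_ring L) (el p \<otimes>\<^bsub>L\<^esub> el (arrow_path Q c))"
        by auto
      moreover have "el (path_comp p (arrow_path Q c)) = el p \<otimes>\<^bsub>L\<^esub> el (arrow_path Q c)"
        using c(1,2) arrow_path_in pp(1) by (simp add: el_comp)
      moreover have "path_comp p (arrow_path Q c) \<in> paths Q"
        using c(1,2) arrow_path_in pp(1) by (simp add: comp_closed)
      ultimately show ?thesis
        by (intro exI[of _ "path_comp p (arrow_path Q c)"]) (auto simp: right_step_def admissible_iff)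
    qed
    show "\<exists>M. \<forall>q N. (right_step ^^ M) p q \<longrightarrow>
        left_submodule (opposite_ring L) (carrier (opposite_ring L)) N \<longrightarrow>
        (\<forall>s\<in>sc ` \<mm>. s \<otimes>\<^bsub>opposite_ring L\<^esub> el p \<in> N) \<longrightarrow> el q \<in> N"
    proof -
      obtain M where M: "\<And>w. w \<in> paths Q \<Longrightarrow> path_length w = M \<Longrightarrow>
          \<exists>g\<in>coefficients_in R \<mm> Q. pr (pe w) = pr g"
        using long_path_coefficients[OF bounded_below] by blast
      have "el q \<in> N"
        if q: "(right_step ^^ M) p q"
          and N: "left_submodule (opposite_ring L) (carrier (opposite_ring L)) N"
          "\<forall>s\<in>sc ` \<mm>. s \<otimes>\<^bsub>opposite_ring L\<^esub> el p \<in> N" for q N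
      proof -
        obtain w where w: "w \<in> paths Q" "path_length w = M" "path_head w = path_tail p"
          "q = path_comp p w" using right_steps[OF q pp(1)] by blast
        obtain g where g: "g \<in> coefficients_in R \<mm> Q" "pr (pe w) = pr g" using M[OF w(1,2)] by blast
        note D = op.left_submoduleD[OF N(1), simplified]
        have "el p \<otimes>\<^bsub>L\<^esub> pr g \<in> N"
          by (rule coefficients_action(2)[OF \<mm>_ideal g(1) D(3,4) pp(3)]) (use D(5) N(2) in auto)
        thus ?thesis using w pp(1) g(2) by (simp add: el_comp) (simp add: path_coset_def)
      qed
      thus ?thesis by blast
    qed
    assume q: "right_step p q"
    obtain c where c: "c \<in> arcs Q" "head Q c = path_tail p" "q = path_comp p (arrow_path Q c)"
      "el q = el p \<otimes>\<^bsub>L\<^esub> el (arrow_path Q c)" "el q \<noteq> \<zero>\<^bsub>L\<^esub>" "q \<in> admissibles"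
      using right_stepE[OF p q] .
    have c4: "el q = el (arrow_path Q c) \<otimes>\<^bsub>opposite_ring L\<^esub> el p" using c(4) by simp
    show "q \<in> admissibles" by (rule c)
    show "el q \<in> left_cyclic (opposite_ring L) (el p)"
      unfolding c4 using el_closed arrow_path_in[OF c(1)] by (intro op.left_cyclicI) simp
    show "el p \<notin> left_cyclic (opposite_ring L) (el q)"
      unfolding c4
      by (rule op.left_cyclic_strict_in_local_image[OF local_image arr finite_arcs _ _ pp'(2) ends pp'(1)])
        (use c el_ends(1)[OF arrow_path_in[OF c(1)]] in simp_all)
  qed
qed

end

theorem theorem1p3:
  fixes R :: "('r, 'x) ring_scheme"
    and \<mm> :: "'r set"
    and Q :: "('v, 'a) pre_digraph"
    and I :: "(('v, 'a) path \<Rightarrow> 'r) set"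
    and p :: "('v, 'a) path"
    and a b :: 'a
  assumes "local_ring_with R \<mm>" and "noetherian_ring R"
    and "fin_digraph Q"
    and "ideal I (path_algebra R Q)"
    and "arrow_radical R Q I" and "bounded_below R \<mm> Q I" and "special R Q I"
    and "admissible R Q I p" and "path_length p \<ge> 1"
    and "left_arrow p = b" and "right_arrow p = a"
  shows "let \<Lambda> = path_algebra R Q Quot I in
     (\<forall>N. left_submodule \<Lambda> (left_path_module R Q I p) N \<and> N \<noteq> {\<zero>\<^bsub>\<Lambda>\<^esub>} \<longrightarrow>
        (\<exists>q. admissible R Q I q \<and> right_subpath Q p q \<and> N = left_path_module R Q I q)) \<and>
     (\<forall>N. right_submodule \<Lambda> (right_path_module R Q I p) N \<and> N \<noteq> {\<zero>\<^bsub>\<Lambda>\<^esub>} \<longrightarrow>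
        (\<exists>q. admissible R Q I q \<and> left_subpath Q p q \<and> N = right_path_module R Q I q)) \<and>
     (\<forall>q. admissible R Q I q \<and> path_length q \<ge> 1 \<and> right_arrow q = a \<and>
        left_path_module R Q I p = left_path_module R Q I q \<longrightarrow> p = q) \<and>
     (\<forall>q. admissible R Q I q \<and> path_length q \<ge> 1 \<and> left_arrow q = b \<and>
        right_path_module R Q I p = right_path_module R Q I q \<longrightarrow> p = q)"
proof -
  interpret cring R using assms(1) by (simp add: local_ring_with_def)
  interpret string_quotient R Q I \<mm>
    by (intro string_quotient.intro quiver_quotient.intro quiver_algebra.intro
        quiver_algebra_axioms.intro quiver_quotient_axioms.intro string_quotient_axioms.intro
        is_cring assms)
  have p: "p \<in> admissibles" "p \<in> paths Q"
    using assms(8,9) by (auto simp: admissibles_def admissible_iff)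
  have reach: "arrow_path Q (right_arrow q) \<in> admissibles"
      "left_step\<^sup>*\<^sup>* (arrow_path Q (right_arrow q)) q"
      "arrow_path Q (left_arrow q) \<in> admissibles"
      "right_step\<^sup>*\<^sup>* (arrow_path Q (left_arrow q)) q"
    if q: "admissible R Q I q" "path_length q \<ge> 1" for q
  proof -
    obtain n where "path_length q = Suc n" using q(2) by (cases "path_length q") auto
    thus "arrow_path Q (right_arrow q) \<in> admissibles"
      "left_step\<^sup>*\<^sup>* (arrow_path Q (right_arrow q)) q"
      "arrow_path Q (left_arrow q) \<in> admissibles"
      "right_step\<^sup>*\<^sup>* (arrow_path Q (left_arrow q)) q"
      using reach_from_right_arrow[OF q(1)] reach_from_left_arrow[OF q(1)] by blast+
  qed
  note r = reach[OF assms(8,9), unfolded assms(10,11)]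
  have right_module: "right_path_module R Q I q = left_cyclic (opposite_ring L) (el q)" for q
    by (simp add: right_path_module_def opposite_ring_modules)
  show ?thesis
    unfolding Let_def
  proof (intro conjI allI impI; elim conjE)
    fix N assume N: "left_submodule L (left_path_module R Q I p) N" "N \<noteq> {\<zero>\<^bsub>L\<^esub>}"
    obtain q where q: "left_step\<^sup>*\<^sup>* p q" "N = left_cyclic L (el q)"
      using left.submodules_of_cyclic[OF p(1), of N] N by (auto simp: left_path_module_def)
    thus "\<exists>q. admissible R Q I q \<and> right_subpath Q p q \<and> N = left_path_module R Q I q"
      using left.steps_in[OF q(1) p(1)] left_steps_subpath[OF q(1) p(2)]
      by (auto simp: left_path_module_def admissibles_def)
  next
    fix N assume N: "right_submodule L (right_path_module R Q I p) N" "N \<noteq> {\<zero>\<^bsub>L\<^esub>}"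
    obtain q where q: "right_step\<^sup>*\<^sup>* p q" "N = left_cyclic (opposite_ring L) (el q)"
      using right.submodules_of_cyclic[OF p(1), of N] N
      by (auto simp: right_module opposite_ring_modules)
    thus "\<exists>q. admissible R Q I q \<and> left_subpath Q p q \<and> N = right_path_module R Q I q"
      using right.steps_in[OF q(1) p(1)] right_steps_subpath[OF q(1) p(2)]
      by (auto simp: right_module admissibles_def)
  next
    fix q assume q: "admissible R Q I q" "path_length q \<ge> 1" "right_arrow q = a"
      and eq: "left_path_module R Q I p = left_path_module R Q I q"
    \<comment> \<open>Equal right arrows mean that \<open>p\<close> and \<open>q\<close> are both
      reached from the path consisting of \<open>a\<close> alone.\<close>
    show "p = q"
      by (rule left.cyclic_determines[OF r(2) reach(2)[OF q(1,2), unfolded q(3)] r(1)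
            eq[unfolded left_path_module_def]])
  next
    fix q assume q: "admissible R Q I q" "path_length q \<ge> 1" "left_arrow q = b"
      and eq: "right_path_module R Q I p = right_path_module R Q I q"
    show "p = q"
      by (rule right.cyclic_determines[OF r(4) reach(4)[OF q(1,2), unfolded q(3)] r(3)
            eq[unfolded right_module]])
  qed
qed

end
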